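(* Let $p$ be a prime. (a) Let $p$ be odd, let $f$ be a $\mathcal C$-function and let $y\in\mathbb Z_p$. The mapping $z\mapsto f(z)$ is ergodic on each sufficiently small sphere centered at $y$ (that is, there is $R$ such that $f$ is ergodic on $S_{p^{-r}}(y)$ for all integers $r\ge R$) if and only if the following two conditions hold simultaneously: $f(y)=y$; and the derivative $f'(y)$ generates modulo $p^2$ the whole group of units $(\mathbb Z/p^2\mathbb Z)^\ast$. (b) Let $p=2$ and $y\in\mathbb Z_2$. For no $\varepsilon>0$ does there exist a $\mathcal C$-function $f$ such that the mapping $z\mapsto f(z)$ is ergodic on all spheres around $y$ of radii less than $\varepsilon$.
   Context: $\mathcal C$ is the class of functions $f\colon\mathbb Z_p\to\mathbb Z_p$ given by a power series $f(x)=\sum_{i\ge0}a_ix^i$ with all $a_i\in\mathbb Z_p$ that converges everywhere on $\mathbb Z_p$ (e.g. polynomials over $\mathbb Z_p$). For an integer $r\ge1$, $S_{p^{-r}}(y)=\{z\in\mathbb Z_p:\|z-y\|_p=p^{-r}\}$; spheres around $y$ are always of this form. $\mu_p$ is the normalized Haar measure on $\mathbb Z_p$ and $\hat\mu_p$ is its restriction to $S_{p^{-r}}(y)$, normalized so that $\hat\mu_p(S_{p^{-r}}(y))=1$. A function $f$ is ergodic on $S_{p^{-r}}(y)$ if $f(S_{p^{-r}}(y))\subset S_{p^{-r}}(y)$ and the restriction of $f$ to the sphere is $\hat\mu_p$-preserving and ergodic with respect to $\hat\mu_p$ (every measurable $A\subset S_{p^{-r}}(y)$ whose preimage under the restriction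 is $A$ has $\hat\mu_p(A)\in\{0,1\}$). *)

theory Defs
  imports
    "HOL-Probability.Infinite_Product_Measure"
    "HOL-Number_Theory.Residues"
    "Berlekamp_Zassenhaus.Finite_Field"
begin

section \<open>The ring of p-adic integers\<close>

text \<open>
  The prime $p$ enters as the cardinality of a type of class \<^class>\<open>prime_card\<close>. The ring of
  $p$-adic integers is the inverse limit of the rings of residues modulo $p^n$; the $n$-th
  component of \<open>x\<close> is the representative of \<open>x\<close> modulo $p^n$ in \<open>{0..<p^n}\<close>.
\<close>

typedef ('p::prime_card) padic_int =
  "{x :: nat \<Rightarrow> int. \<forall>n. x n \<in> {0..<int CARD('p) ^ n} \<and> x (Suc n) mod int CARD('p) ^ n = x n}"
  morphisms padic_residue Abs_padic_int
  by (rule exI[of _ "\<lambda>_. 0"]) simp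

setup_lifting type_definition_padic_int

lemma CARD_prime_ge_2: "int CARD('p::prime_card) \<ge> 2"
  using prime_ge_2_nat[OF prime_card[where 'a='p]] by simp

lemma padic_residue_bounds:
  fixes x :: "'p::prime_card padic_int"
  shows "0 \<le> padic_residue x n" "padic_residue x n < int CARD('p) ^ n"
  using padic_residue[of x] by auto

lemma padic_residue_mod_self [simp]:
  fixes x :: "'p::prime_card padic_int"
  shows "padic_residue x n mod int CARD('p) ^ n = padic_residue x n"
  using padic_residue_bounds[of x n] by simp

lemma padic_residue_mod:
  fixes x :: "'p::prime_card padic_int"
  assumes "m \<le> n"
  shows "padic_residue x n mod int CARD('p) ^ m = padic_residue x m"
  using assms
proof (induction n rule: dec_induct)
  case base
  show ?case by simp
next
  case (step n)
  have "padic_residue x (Suc n) mod int CARD('p) ^ n = padic_residue x n"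
    using padic_residue[of x] by simp
  with step show ?case
    by (metis le_imp_power_dvd mod_mod_cancel)
qed

lemma padic_int_eqI: "(\<And>n. padic_residue x n = padic_residue y n) \<Longrightarrow> x = y"
  by (metis ext padic_residue_inject)

instantiation padic_int :: (prime_card) comm_ring_1
begin

lift_definition zero_padic_int :: "'a padic_int" is "\<lambda>_. 0"
  by simp

lift_definition one_padic_int :: "'a padic_int" is "\<lambda>n. 1 mod int CARD('a) ^ n"
  by (simp add: mod_mod_cancel)

lift_definition plus_padic_int :: "'a padic_int \<Rightarrow> 'a padic_int \<Rightarrow> 'a padic_int"
  is "\<lambda>x y n. (x n + y n) mod int CARD('a) ^ n"
  by (simp add: mod_mod_cancel) (metis mod_add_eq)

lift_definition uminus_padic_int :: "'a padic_int \<Rightarrow> 'a padic_int"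
  is "\<lambda>x n. (- x n) mod int CARD('a) ^ n"
  by (simp add: mod_mod_cancel) (metis mod_minus_eq)

lift_definition minus_padic_int :: "'a padic_int \<Rightarrow> 'a padic_int \<Rightarrow> 'a padic_int"
  is "\<lambda>x y n. (x n - y n) mod int CARD('a) ^ n"
  by (simp add: mod_mod_cancel) (metis mod_diff_eq)

lift_definition times_padic_int :: "'a padic_int \<Rightarrow> 'a padic_int \<Rightarrow> 'a padic_int"
  is "\<lambda>x y n. (x n * y n) mod int CARD('a) ^ n"
  by (simp add: mod_mod_cancel) (metis mod_mult_eq)

instance
proof
  fix a b c :: "'a padic_int"
  show "a * b * c = a * (b * c)"
    by transfer (simp add: mod_simps ac_simps)
  show "a * b = b * a"
    by transfer (simp add: ac_simps)
  show "1 * a = a"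
    by transfer (auto simp: mod_simps)
  show "a + b + c = a + (b + c)"
    by transfer (simp add: mod_simps ac_simps)
  show "a + b = b + a"
    by transfer (simp add: ac_simps)
  show "0 + a = a"
    by transfer auto
  show "- a + a = 0"
    by transfer (simp add: mod_simps)
  show "a - b = a + - b"
    by transfer (simp add: mod_simps)
  show "(a + b) * c = a * c + b * c"
    by transfer (simp add: mod_simps algebra_simps)
  have "(\<lambda>_. 0) \<noteq> (\<lambda>n. 1 mod int CARD('a) ^ n)"
    using CARD_prime_ge_2[where 'p='a] by (auto simp: fun_eq_iff intro!: exI[of _ 1])
  then show "(0::'a padic_int) \<noteq> 1"
    by transfer
qed

end

lemmas padic_residue_simps =
  zero_padic_int.rep_eq one_padic_int.rep_eq plus_padic_int.rep_eq uminus_padic_int.rep_eq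
  minus_padic_int.rep_eq times_padic_int.rep_eq

lemma padic_residue_diff_eq_0_iff:
  fixes x y :: "'p::prime_card padic_int"
  shows "padic_residue (x - y) n = 0 \<longleftrightarrow> padic_residue x n = padic_residue y n"
  by (metis minus_padic_int.rep_eq mod_eq_dvd_iff dvd_eq_mod_eq_0 padic_residue_mod_self)


section \<open>The p-adic metric\<close>

text \<open>
  For \<open>x \<noteq> 0\<close> the exponent in the norm is the $p$-adic valuation of \<open>x\<close>: the largest $v$ such
  that \<open>x\<close> vanishes modulo $p^v$.
\<close>

definition padic_norm :: "'p::prime_card padic_int \<Rightarrow> real" where
  "padic_norm x = (if x = 0 then 0
                   else 1 / real CARD('p) ^ (LEAST v. padic_residue x (Suc v) \<noteq> 0))"

lemma padic_norm_le_iff: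
  fixes x :: "'p::prime_card padic_int"
  shows "padic_norm x \<le> 1 / real CARD('p) ^ n \<longleftrightarrow> padic_residue x n = 0"
proof (cases "x = 0")
  case True
  then show ?thesis by (simp add: padic_norm_def zero_padic_int.rep_eq)
next
  case False
  let ?v = "LEAST v. padic_residue x (Suc v) \<noteq> 0"
  have p: "real CARD('p) > 1"
    using CARD_prime_ge_2[where 'p='p] by linarith
  have res0: "padic_residue x 0 = 0"
    using padic_residue_bounds[of x 0] by simp
  from False obtain k where "padic_residue x k \<noteq> 0"
    by (metis padic_int_eqI zero_padic_int.rep_eq)
  with res0 obtain j where "padic_residue x (Suc j) \<noteq> 0"
    by (cases k) auto
  then have v: "padic_residue x (Suc ?v) \<noteq> 0"
    by (rule LeastI)
  have below: "padic_residue x (Suc j) = 0" if "j < ?v" for j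
    using not_less_Least[OF that] by simp
  have "padic_residue x n = 0 \<longleftrightarrow> n \<le> ?v"
  proof
    assume *: "padic_residue x n = 0"
    show "n \<le> ?v"
    proof (rule ccontr)
      assume "\<not> n \<le> ?v"
      then have "padic_residue x n mod int CARD('p) ^ Suc ?v = padic_residue x (Suc ?v)"
        by (intro padic_residue_mod) simp
      with * v show False by simp
    qed
  next
    assume "n \<le> ?v"
    show "padic_residue x n = 0"
    proof (cases n)
      case 0
      with res0 show ?thesis by (simp only:)
    next
      case (Suc j)
      with \<open>n \<le> ?v\<close> have "j < ?v" by (simp only: Suc_le_eq)
      with below Suc show ?thesis by blast
    qed
  qed
  moreover have "padic_norm x \<le> 1 / real CARD('p) ^ n \<longleftrightarrow> n \<le> ?v"
    using False p by (simp add: padic_norm_def field_simps)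
  ultimately show ?thesis by simp
qed

lemma padic_norm_cases: "padic_norm x = 0 \<or> (\<exists>n. padic_norm x = 1 / real CARD('p) ^ n)"
  for x :: "'p::prime_card padic_int"
  by (cases "x = 0") (auto simp: padic_norm_def)

lemma padic_norm_eq_0_iff: "padic_norm (x :: 'p::prime_card padic_int) = 0 \<longleftrightarrow> x = 0"
  by (auto simp: padic_norm_def)

lemma padic_norm_nonneg: "padic_norm (x :: 'p::prime_card padic_int) \<ge> 0"
  by (auto simp: padic_norm_def)

instantiation padic_int :: (prime_card) metric_space
begin

definition dist_padic_int :: "'a padic_int \<Rightarrow> 'a padic_int \<Rightarrow> real" where
  "dist x y = padic_norm (x - y :: 'a padic_int)"

definition uniformity_padic_int :: "('a padic_int \<times> 'a padic_int) filter" where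
  "uniformity = (INF e\<in>{0<..}. principal {(x :: 'a padic_int, y). dist x y < e})"

definition open_padic_int :: "'a padic_int set \<Rightarrow> bool" where
  "open (U :: 'a padic_int set) \<longleftrightarrow> (\<forall>x\<in>U. eventually (\<lambda>(x', y). x' = x \<longrightarrow> y \<in> U) uniformity)"

lemma dist_padic_le_iff:
  fixes x y :: "'a padic_int"
  shows "dist x y \<le> 1 / real CARD('a) ^ n \<longleftrightarrow> padic_residue x n = padic_residue y n"
  by (simp add: dist_padic_int_def padic_norm_le_iff padic_residue_diff_eq_0_iff)

lemma dist_padic_ultrametric:
  fixes x y z :: "'a padic_int"
  shows "dist x y \<le> max (dist x z) (dist y z)"
proof -
  define e where "e = max (dist x z) (dist y z)"
  have le: "dist x z \<le> e" "dist y z \<le> e"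
    by (simp_all add: e_def)
  have "e = 0 \<or> (\<exists>n. e = 1 / real CARD('a) ^ n)"
    using padic_norm_cases[of "x - z"] padic_norm_cases[of "y - z"]
    unfolding e_def dist_padic_int_def max_def by presburger
  then show ?thesis
  proof
    assume "e = 0"
    with le have "x - z = 0" "y - z = 0"
      unfolding dist_padic_int_def
      by (metis padic_norm_eq_0_iff padic_norm_nonneg order_antisym)+
    then have "x - y = 0"
      by (metis diff_0_right eq_iff_diff_eq_0)
    then show ?thesis
      using le \<open>e = 0\<close> e_def by (simp add: dist_padic_int_def padic_norm_def)
  next
    assume "\<exists>n. e = 1 / real CARD('a) ^ n"
    then obtain n where n: "e = 1 / real CARD('a) ^ n" ..
    from le have "padic_residue x n = padic_residue z n" "padic_residue y n = padic_residue z n"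
      unfolding n dist_padic_le_iff .
    then have "dist x y \<le> e"
      unfolding n dist_padic_le_iff by (rule trans[OF _ sym])
    then show ?thesis by (simp only: e_def)
  qed
qed

instance
proof
  fix x y z :: "'a padic_int"
  show "dist x y = 0 \<longleftrightarrow> x = y"
    by (simp add: dist_padic_int_def padic_norm_eq_0_iff)
  show "dist x y \<le> dist x z + dist y z"
    using dist_padic_ultrametric[of x y z] padic_norm_nonneg[of "x - z"] padic_norm_nonneg[of "y - z"]
    by (simp add: dist_padic_int_def)
next
  show "uniformity = (INF e\<in>{0<..}. principal {(x :: 'a padic_int, y). dist x y < e})"
    by (rule uniformity_padic_int_def)
  show "open U \<longleftrightarrow> (\<forall>x\<in>U. eventually (\<lambda>(x', y). x' = x \<longrightarrow> y \<in> U) uniformity)"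
    for U :: "'a padic_int set"
    by (rule open_padic_int_def)
qed

end


section \<open>Power series and derivatives\<close>

text \<open>
  The functions on the $p$-adic integers given by an everywhere convergent power series with
  $p$-adic integer coefficients.
\<close>

definition C_function :: "('p::prime_card padic_int \<Rightarrow> 'p padic_int) \<Rightarrow> bool" where
  "C_function f \<longleftrightarrow> (\<exists>a. \<forall>x. (\<lambda>i. a i * x ^ i) sums f x)"

text \<open>
  The difference quotient lives in the field of fractions. By multiplicativity of the norm,
  its distance to \<open>d\<close> is the quotient of norms below. The derivative, if it exists, is unique
  (lemma \<open>has_padic_derivative_unique\<close>).
\<close>

definition has_padic_derivative ::
    "('p::prime_card padic_int \<Rightarrow> 'p padic_int) \<Rightarrow> 'p padic_int \<Rightarrow> 'p padic_int \<Rightarrow> bool" where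
  "has_padic_derivative f d y \<longleftrightarrow>
     ((\<lambda>x. padic_norm (f x - f y - d * (x - y)) / padic_norm (x - y)) \<longlongrightarrow> 0) (at y)"

definition padic_deriv ::
    "('p::prime_card padic_int \<Rightarrow> 'p padic_int) \<Rightarrow> 'p padic_int \<Rightarrow> 'p padic_int" where
  "padic_deriv f y = (THE d. has_padic_derivative f d y)"

lemma padic_residue_of_nat:
  "padic_residue (of_nat k :: 'p::prime_card padic_int) n = int k mod int CARD('p) ^ n"
  by (induction k) (simp_all add: padic_residue_simps mod_simps add.commute)

lemma padic_norm_mult_p_power_le_iff:
  fixes x :: "'p::prime_card padic_int"
  shows "padic_norm (x * of_nat CARD('p) ^ n) \<le> 1 / real CARD('p) ^ (k + n) \<longleftrightarrow>
         padic_norm x \<le> 1 / real CARD('p) ^ k"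
proof -
  let ?p = "int CARD('p)"
  have p: "?p > 0" using CARD_prime_ge_2[where 'p='p] by linarith
  have "padic_residue (x * of_nat CARD('p) ^ n) (k + n) = 0 \<longleftrightarrow>
        ?p ^ (k + n) dvd padic_residue x (k + n) * (?p ^ n mod ?p ^ (k + n))"
    using padic_residue_of_nat[where 'p='p, of "CARD('p) ^ n" "k + n"]
    by (simp add: times_padic_int.rep_eq mod_eq_0_iff_dvd)
  also have "\<dots> \<longleftrightarrow> ?p ^ k * ?p ^ n dvd padic_residue x (k + n) * ?p ^ n"
    by (simp only: dvd_eq_mod_eq_0 mod_mult_right_eq power_add)
  also have "\<dots> \<longleftrightarrow> ?p ^ k dvd padic_residue x (k + n)"
    using p by simp
  also have "\<dots> \<longleftrightarrow> padic_residue x k = 0"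
    by (simp only: dvd_eq_mod_eq_0 padic_residue_mod[OF le_add1])
  finally show ?thesis by (simp add: padic_norm_le_iff)
qed

lemma has_padic_derivative_unique:
  fixes f :: "'p::prime_card padic_int \<Rightarrow> 'p padic_int"
  assumes "has_padic_derivative f d y" "has_padic_derivative f d' y"
  shows "d = d'"
proof (rule ccontr)
  assume "d \<noteq> d'"
  let ?p = "real CARD('p)"
  define x where "x n = y + of_nat CARD('p) ^ n" for n
  have p: "?p > 1" using CARD_prime_ge_2[where 'p='p] by linarith
  from \<open>d \<noteq> d'\<close> obtain k where "padic_residue d k \<noteq> padic_residue d' k"
    using padic_int_eqI by blast
  then have k: "\<not> padic_norm (d - d') \<le> 1 / ?p ^ k"
    by (simp add: padic_norm_le_iff padic_residue_diff_eq_0_iff)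
  have low: "\<not> padic_norm ((d - d') * (x n - y)) \<le> 1 / ?p ^ (k + n)" for n
    using k by (simp add: x_def padic_norm_mult_p_power_le_iff)
  have nz: "x n - y \<noteq> 0" for n
    using low[of n] p by (auto simp: padic_norm_def)
  have up: "padic_norm (x n - y) \<le> 1 / ?p ^ n" for n
    using padic_norm_mult_p_power_le_iff[where 'p='p, of 1 n 0]
      padic_norm_le_iff[where 'p='p, of 1 0] padic_residue_bounds[of "1::'p padic_int" 0]
    by (simp add: x_def)
  have "x \<longlonglongrightarrow> y"
  proof (rule metric_LIMSEQ_I)
    fix e :: real assume "e > 0"
    then obtain N where N: "(1 / ?p) ^ N < e"
      using real_arch_pow_inv[of e "1 / ?p"] p by auto
    have "dist (x n) y < e" if "n \<ge> N" for n
    proof -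
      have "dist (x n) y \<le> (1 / ?p) ^ n"
        using up by (simp add: dist_padic_int_def power_one_over)
      also have "\<dots> \<le> (1 / ?p) ^ N"
        using that p by (intro power_decreasing) auto
      finally show ?thesis using N by simp
    qed
    then show "\<exists>N. \<forall>n\<ge>N. dist (x n) y < e" by blast
  qed
  then have at: "filterlim x (at y) sequentially"
    using nz by (intro filterlim_atI) simp_all
  let ?q = "\<lambda>d n. padic_norm (f (x n) - f y - d * (x n - y)) / padic_norm (x n - y)"
  have lim: "(\<lambda>n. max (?q d n) (?q d' n)) \<longlonglongrightarrow> max 0 0"
    using assms unfolding has_padic_derivative_def
    by (intro tendsto_max filterlim_compose[OF _ at])
  have "1 / ?p ^ k \<le> max (?q d n) (?q d' n)" for n
  proof -
    have pos: "padic_norm (x n - y) > 0"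
      using nz[of n] padic_norm_nonneg[of "x n - y"] padic_norm_eq_0_iff[of "x n - y"] by linarith
    have "1 / ?p ^ k * padic_norm (x n - y) \<le> 1 / ?p ^ k * (1 / ?p ^ n)"
      using up by (intro mult_left_mono) auto
    also have "\<dots> \<le> padic_norm ((d - d') * (x n - y))"
      using low[of n] by (simp add: power_add)
    also have "\<dots> = dist (f (x n) - f y - d' * (x n - y)) (f (x n) - f y - d * (x n - y))"
      by (simp add: dist_padic_int_def algebra_simps)
    also have "\<dots> \<le> max (dist (f (x n) - f y - d' * (x n - y)) 0)
                            (dist (f (x n) - f y - d * (x n - y)) 0)"
      by (rule dist_padic_ultrametric)
    finally have "1 / ?p ^ k \<le> max (padic_norm (f (x n) - f y - d' * (x n - y)))
                   (padic_norm (f (x n) - f y - d * (x n - y))) / padic_norm (x n - y)"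
      using pos by (simp add: pos_le_divide_eq dist_padic_int_def)
    then show ?thesis
      using pos by (simp add: max_def divide_right_mono split: if_splits)
  qed
  then have "1 / ?p ^ k \<le> max 0 0"
    by (intro LIMSEQ_le_const[OF lim]) auto
  moreover have "1 / ?p ^ k > 0" using p by simp
  ultimately show False by linarith
qed

lemma padic_deriv_eqI: "has_padic_derivative f d y \<Longrightarrow> padic_deriv f y = d"
  unfolding padic_deriv_def by (rule the_equality) (auto intro: has_padic_derivative_unique)


section \<open>Haar measure\<close>

text \<open>
  The Haar measure is taken on the Borel sets and singled out by invariance under translations
  and total mass 1; existence and uniqueness are proved in \<open>normalized_haar_haar\<close>.
\<close>

definition normalized_haar :: "'p::prime_card padic_int measure \<Rightarrow> bool" where
  "normalized_haar M \<longleftrightarrow> sets M = sets borel \<and> emeasure M UNIV = 1 \<and>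
     (\<forall>a. \<forall>A\<in>sets borel. emeasure M ((+) a ` A) = emeasure M A)"

definition haar :: "'p::prime_card padic_int measure" where
  "haar = (THE M. normalized_haar M)"

definition residue_class :: "nat \<Rightarrow> int \<Rightarrow> 'p::prime_card padic_int set" where
  "residue_class n c = {x. padic_residue x n = c}"

lemma residue_class_nonempty:
  assumes "0 \<le> c" "c < int CARD('p) ^ n"
  shows "of_nat (nat c) \<in> (residue_class n c :: 'p::prime_card padic_int set)"
  using assms padic_residue_of_nat[where 'p='p, of "nat c" n]
  by (simp add: residue_class_def del: of_nat_nat)

lemma residue_class_empty:
  assumes "c \<notin> {0..<int CARD('p) ^ n}"
  shows "(residue_class n c :: 'p::prime_card padic_int set) = {}"
  using assms padic_residue_bounds by (fastforce simp: residue_class_def)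

lemma residue_class_eq_cball:
  fixes x :: "'p::prime_card padic_int"
  shows "residue_class n (padic_residue x n) = cball x (1 / real CARD('p) ^ n)"
  by (auto simp: residue_class_def dist_padic_le_iff)

lemma residue_class_subset_open:
  fixes x :: "'p::prime_card padic_int"
  assumes "open U" "x \<in> U"
  shows "\<exists>n. residue_class n (padic_residue x n) \<subseteq> U"
proof -
  have p: "real CARD('p) > 1" using CARD_prime_ge_2[where 'p='p] by linarith
  from assms obtain e where e: "e > 0" "cball x e \<subseteq> U"
    using open_contains_cball by blast
  then obtain n where "(1 / real CARD('p)) ^ n < e"
    using real_arch_pow_inv[of e "1 / real CARD('p)"] p by auto
  then have "cball x (1 / real CARD('p) ^ n) \<subseteq> cball x e"
    by (auto simp: power_one_over)
  with e show ?thesis by (metis residue_class_eq_cball order_trans)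
qed

lemma open_residue_class: "open (residue_class n c :: 'p::prime_card padic_int set)"
proof (rule openI)
  fix x :: "'p padic_int" assume x: "x \<in> residue_class n c"
  have "ball x (1 / real CARD('p) ^ n) \<subseteq> cball x (1 / real CARD('p) ^ n)"
    by auto
  also have "\<dots> = residue_class n c"
    using x residue_class_eq_cball[of n x] by (simp add: residue_class_def)
  finally show "\<exists>e>0. ball x e \<subseteq> residue_class n c"
    using CARD_prime_ge_2[where 'p='p] by (intro exI[of _ "1 / real CARD('p) ^ n"]) auto
qed

abbreviation residue_classes :: "'p::prime_card padic_int set set" where
  "residue_classes \<equiv> range (\<lambda>(n, c). residue_class n c)"

lemma sets_borel_padic:
  "sets (borel :: 'p::prime_card padic_int measure) = sigma_sets UNIV residue_classes"
proof -
  have "sigma_sets UNIV {S :: 'p padic_int set. open S} = sigma_sets UNIV residue_classes"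
  proof (rule sigma_sets_eqI)
    fix U :: "'p padic_int set" assume "U \<in> {S. open S}"
    then have "open U" by simp
    then have "U = \<Union>{B \<in> residue_classes. B \<subseteq> U}"
      using residue_class_subset_open[of U] by (fastforce simp: residue_class_def)
    also have "\<dots> \<in> sigma_sets UNIV residue_classes"
      by (rule sigma_sets_UNION) (auto intro: countable_subset[of _ residue_classes])
    finally show "U \<in> sigma_sets UNIV residue_classes" .
  qed (auto simp: open_residue_class)
  then show ?thesis by (simp add: borel_def)
qed

lemma Int_stable_residue_classes: "Int_stable (residue_classes :: 'p::prime_card padic_int set set)"
proof -
  have *: "(residue_class m c :: 'p padic_int set) \<inter> residue_class n d \<in> residue_classes"
    if "m \<le> n" for m n c d
  proof (cases "d mod int CARD('p) ^ m = c")
    case True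
    then have "(residue_class m c :: 'p padic_int set) \<inter> residue_class n d = residue_class n d"
      using that by (auto simp: residue_class_def padic_residue_mod)
    then show ?thesis by auto
  next
    case False
    then have "(residue_class m c :: 'p padic_int set) \<inter> residue_class n d = residue_class 0 1"
      using that residue_class_empty[where 'p='p, of 1 0]
      by (auto simp: residue_class_def padic_residue_mod)
    then show ?thesis by auto
  qed
  show ?thesis
    unfolding Int_stable_def
  proof safe
    fix m n :: nat and c d :: int
    show "(residue_class m c :: 'p padic_int set) \<inter> residue_class n d \<in> residue_classes"
      using *[of m n c d] *[of n m d c] by (cases "m \<le> n") (simp_all add: Int_commute)
  qed
qed

lemma padic_measure_eqI:
  fixes M N :: "'p::prime_card padic_int measure"
  assumes "sets M = sets borel" "sets N = sets borel" "emeasure M UNIV = 1"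
    and "\<And>n c. c \<in> {0..<int CARD('p) ^ n} \<Longrightarrow>
           emeasure M (residue_class n c) = emeasure N (residue_class n c)"
  shows "M = N"
proof (rule measure_eqI_generator_eq[where A = "\<lambda>_. UNIV"])
  show "Int_stable (residue_classes :: 'p padic_int set set)"
    by (rule Int_stable_residue_classes)
  show "emeasure M X = emeasure N X" if X: "X \<in> residue_classes" for X
  proof -
    from X obtain n c where "X = residue_class n c" by auto
    with assms(4)[of c n] residue_class_empty[where 'p='p, of c n] show ?thesis
      by (cases "c \<in> {0..<int CARD('p) ^ n}") auto
  qed
  have "residue_class 0 0 = (UNIV :: 'p padic_int set)"
  proof -
    have "padic_residue x 0 = 0" for x :: "'p padic_int"
      using padic_residue_bounds[of x 0] by simp
    then show ?thesis by (simp add: residue_class_def)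
  qed
  then show "range (\<lambda>_. UNIV) \<subseteq> (residue_classes :: 'p padic_int set set)"
    by (metis (mono_tags, lifting) case_prod_conv image_subsetI rangeI)
qed (use assms in \<open>auto simp: sets_borel_padic\<close>)

lemma image_plus_residue_class:
  fixes t :: "'p::prime_card padic_int"
  shows "(+) t ` residue_class n c =
    (if c \<in> {0..<int CARD('p) ^ n}
     then residue_class n ((padic_residue t n + c) mod int CARD('p) ^ n) else {})"
proof (cases "c \<in> {0..<int CARD('p) ^ n}")
  case True
  have "x \<in> (+) t ` residue_class n c"
    if "padic_residue x n = (padic_residue t n + c) mod int CARD('p) ^ n" for x
  proof (rule image_eqI)
    show "x = t + (x - t)" by simp
    have "padic_residue (x - t) n = c mod int CARD('p) ^ n"
      using that by (simp add: padic_residue_simps mod_simps)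
    with True show "x - t \<in> residue_class n c" by (simp add: residue_class_def)
  qed
  with True show ?thesis by (auto simp: residue_class_def padic_residue_simps)
next
  case False
  with residue_class_empty[OF False] show ?thesis by (simp only: image_empty if_False)
qed

lemma emeasure_haar_residue_class:
  fixes M :: "'p::prime_card padic_int measure"
  assumes "normalized_haar M" "c \<in> {0..<int CARD('p) ^ n}"
  shows "emeasure M (residue_class n c) = ennreal (1 / real CARD('p) ^ n)"
proof -
  let ?I = "{0..<int CARD('p) ^ n}"
  define P where "P = real CARD('p) ^ n"
  from assms have sets: "sets M = sets borel" and one: "emeasure M UNIV = 1"
    and inv: "\<And>a A. A \<in> sets borel \<Longrightarrow> emeasure M ((+) a ` A) = emeasure M A"
    by (auto simp: normalized_haar_def)
  have p: "int CARD('p) ^ n > 0" using CARD_prime_ge_2[where 'p='p] by simp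
  have eq: "emeasure M (residue_class n c) = emeasure M (residue_class n 0)" if "c \<in> ?I" for c
  proof -
    have "(residue_class n c :: 'p padic_int set) = (+) (of_nat (nat c)) ` residue_class n 0"
      using that p padic_residue_of_nat[where 'p='p, of "nat c" n]
      by (simp add: image_plus_residue_class del: of_nat_nat)
    then show ?thesis by (simp only: inv[OF borel_open[OF open_residue_class]])
  qed
  have "1 = emeasure M (\<Union>c\<in>?I. residue_class n c)"
  proof -
    have "(\<Union>c\<in>?I. residue_class n c) = (UNIV :: 'p padic_int set)"
      using padic_residue_bounds[where 'p='p, of _ n] by (auto simp: residue_class_def)
    then show ?thesis using one by simp
  qed
  also have "\<dots> = (\<Sum>c\<in>?I. emeasure M (residue_class n c))"
  proof (rule sum_emeasure[symmetric])
    show "residue_class n ` ?I \<subseteq> sets M"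
      by (auto simp: sets intro: borel_open open_residue_class)
    show "disjoint_family_on (residue_class n :: int \<Rightarrow> 'p padic_int set) ?I"
      by (auto simp: disjoint_family_on_def residue_class_def)
  qed simp
  also have "\<dots> = (\<Sum>c\<in>?I. emeasure M (residue_class n 0))"
    by (rule sum.cong[OF refl eq])
  also have "\<dots> = of_nat (card ?I) * emeasure M (residue_class n 0)"
    by (rule sum_constant)
  also have "card ?I = CARD('p) ^ n"
    by (simp add: nat_power_eq)
  also have "of_nat (CARD('p) ^ n) = ennreal P"
    by (simp add: P_def ennreal_of_nat_eq_real_of_nat)
  finally have one': "ennreal P * emeasure M (residue_class n 0) = 1" ..
  have "P > 0" using CARD_prime_ge_2[where 'p='p] by (simp add: P_def)
  then have inv_P: "ennreal (1 / P) * ennreal P = 1"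
    by (simp flip: ennreal_mult)
  have "emeasure M (residue_class n c) = emeasure M (residue_class n 0)"
    by (rule eq[OF assms(2)])
  also have "\<dots> = ennreal (1 / P) * ennreal P * emeasure M (residue_class n 0)"
    by (simp only: inv_P mult_1_left)
  also have "\<dots> = ennreal (1 / P)"
    by (simp only: mult.assoc one' mult_1_right)
  finally show ?thesis by (simp only: P_def)
qed

lift_definition digits_to_padic :: "(nat \<Rightarrow> int) \<Rightarrow> 'p::prime_card padic_int"
  is "\<lambda>d n. (\<Sum>i<n. d i * int CARD('p) ^ i) mod int CARD('p) ^ n"
  by (simp add: mod_mod_cancel)

lemma digit_sum:
  fixes p :: int
  assumes "p > 0" "\<And>i. d i \<in> {0..<p}"
  shows "(\<Sum>i<n. d i * p ^ i) \<in> {0..<p ^ n} \<and>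
         (c \<in> {0..<p ^ n} \<longrightarrow> ((\<Sum>i<n. d i * p ^ i) = c \<longleftrightarrow> (\<forall>i<n. d i = c div p ^ i mod p)))"
proof (induction n arbitrary: c)
  case (Suc n)
  let ?s = "\<Sum>i<n. d i * p ^ i"
  have s: "0 \<le> ?s" "?s < p ^ n" using Suc.IH by auto
  have "d n * p ^ n + p ^ n \<le> p * p ^ n"
    using assms(2)[of n] assms(1) mult_right_mono[of "d n + 1" p "p ^ n"] by (simp add: algebra_simps)
  moreover have "0 \<le> d n * p ^ n" using assms(2)[of n] assms(1) by simp
  ultimately have range: "?s + d n * p ^ n \<in> {0..<p ^ Suc n}" using s by auto
  have "?s + d n * p ^ n = c \<longleftrightarrow> (\<forall>i<Suc n. d i = c div p ^ i mod p)" if c: "c \<in> {0..<p ^ Suc n}"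
  proof -
    have cn: "c mod p ^ n \<in> {0..<p ^ n}" using assms(1) by simp
    have low: "(c mod p ^ n) div p ^ i mod p = c div p ^ i mod p" if "i < n" for i
    proof -
      have n: "p ^ n = p ^ i * p ^ (n - i)" using that by (simp flip: power_add)
      have "(c mod p ^ n) div p ^ i = c div p ^ i mod p ^ (n - i)"
        unfolding n using assms(1) by (simp add: zmod_zmult2_eq)
      also have "\<dots> mod p = c div p ^ i mod p"
        using that by (intro mod_mod_cancel) (simp add: dvd_power)
      finally show ?thesis .
    qed
    have "c div p ^ n * p ^ n < p * p ^ n"
      using c div_mult_mod_eq[of c "p ^ n"] pos_mod_sign[of "p ^ n" c] zero_less_power[OF assms(1), of n]
      unfolding atLeastLessThan_iff power_Suc by linarith
    then have "c div p ^ n < p"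
      by (rule mult_right_less_imp_less) (use assms(1) in simp)
    then have "c div p ^ n \<in> {0..<p}"
      using c assms(1) by (simp add: pos_imp_zdiv_nonneg_iff)
    then have top: "c div p ^ n mod p = c div p ^ n" by simp
    have "?s + d n * p ^ n = c \<longleftrightarrow> ?s = c mod p ^ n \<and> d n = c div p ^ n"
    proof
      assume "?s + d n * p ^ n = c"
      moreover have "(?s + d n * p ^ n) div p ^ n = d n" "(?s + d n * p ^ n) mod p ^ n = ?s"
        using s assms(1) by (simp_all add: div_pos_pos_trivial)
      ultimately show "?s = c mod p ^ n \<and> d n = c div p ^ n" by simp
    next
      assume "?s = c mod p ^ n \<and> d n = c div p ^ n"
      then show "?s + d n * p ^ n = c" by (simp add: mod_div_mult_eq)
    qed
    also have "\<dots> \<longleftrightarrow> (\<forall>i<n. d i = c div p ^ i mod p) \<and> d n = c div p ^ n mod p"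
      unfolding top using Suc.IH[of "c mod p ^ n"] cn by (simp only: low cong: imp_cong)
    also have "\<dots> \<longleftrightarrow> (\<forall>i<Suc n. d i = c div p ^ i mod p)"
      by (auto simp only: less_Suc_eq)
    finally show ?thesis .
  qed
  with range show ?case by simp
qed simp

lemma normalized_haar_exists: "\<exists>M :: 'p::prime_card padic_int measure. normalized_haar M"
proof -
  let ?p = "int CARD('p)"
  define U where "U = (\<lambda>_::nat. uniform_count_measure {0..<?p})"
  define D where "D = Pi\<^sub>M UNIV U"
  define M :: "'p padic_int measure" where "M = distr D borel digits_to_padic"
  have p: "?p > 0" using CARD_prime_ge_2[where 'p='p] by linarith
  interpret U: prob_space "U i" for i
    unfolding U_def using p by (intro prob_space_uniform_count_measure) auto
  interpret product_prob_space U UNIV ..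
  have space_D: "space D = {d. \<forall>i. d i \<in> {0..<?p}}"
    by (auto simp: D_def U_def space_PiM space_uniform_count_measure PiE_def Pi_def)
  have vimage: "digits_to_padic -` (residue_class n c :: 'p padic_int set) \<inter> space D =
      {d \<in> space D. \<forall>i\<in>{..<n}. d i \<in> {c div ?p ^ i mod ?p}}"
    if "c \<in> {0..<?p ^ n}" for n c
  proof -
    have "d \<in> digits_to_padic -` (residue_class n c :: 'p padic_int set) \<longleftrightarrow>
        (\<forall>i\<in>{..<n}. d i \<in> {c div ?p ^ i mod ?p})" if d: "d \<in> space D" for d
    proof -
      have "\<And>i. d i \<in> {0..<?p}" using d by (simp add: space_D)
      from digit_sum[of ?p d n c, OF p this] \<open>c \<in> {0..<?p ^ n}\<close> show ?thesis
        by (auto simp: residue_class_def digits_to_padic.rep_eq)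
    qed
    then show ?thesis by blast
  qed
  have cyl: "{c div ?p ^ i mod ?p} \<in> sets (U i)" for c i
    using p by (simp add: U_def sets_uniform_count_measure)
  have meas: "digits_to_padic \<in> measurable D (borel :: 'p padic_int measure)"
  proof (rule measurable_sigma_sets[OF sets_borel_padic])
    fix B :: "'p padic_int set" assume "B \<in> residue_classes"
    then obtain n c where B: "B = residue_class n c" by auto
    show "digits_to_padic -` B \<inter> space D \<in> sets D"
    proof (cases "c \<in> {0..<?p ^ n}")
      case True
      show ?thesis
        unfolding B vimage[OF True] unfolding D_def
        by (intro sets.sets_Collect_finite_All sets_Collect_single) (use cyl in auto)
    next
      case False
      show ?thesis unfolding B residue_class_empty[OF False] by simp
    qed
  qed auto
  have M: "emeasure M (residue_class n c) = ennreal (1 / real CARD('p) ^ n)"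
    if "c \<in> {0..<?p ^ n}" for n c
  proof -
    have "emeasure M (residue_class n c) = emeasure D {d \<in> space D. \<forall>i\<in>{..<n}. d i \<in> {c div ?p ^ i mod ?p}}"
      unfolding M_def using meas that
      by (simp add: emeasure_distr open_residue_class vimage)
    also have "\<dots> = (\<Prod>i<n. emeasure (U i) {c div ?p ^ i mod ?p})"
      unfolding D_def by (intro emeasure_PiM_Collect) (use cyl in auto)
    also have "\<dots> = (\<Prod>i<n. ennreal (1 / real CARD('p)))"
      using p by (intro prod.cong) (auto simp: U_def emeasure_uniform_count_measure)
    also have "\<dots> = ennreal (1 / real CARD('p) ^ n)"
      by (simp add: ennreal_power power_one_over)
    finally show ?thesis .
  qed
  have setsM: "sets M = sets borel" by (simp add: M_def)
  have one: "emeasure M UNIV = 1"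
  proof -
    interpret M: prob_space M
      unfolding M_def by (rule P.prob_space_distr[folded D_def]) (rule meas)
    show ?thesis using M.emeasure_space_1 by (simp add: M_def)
  qed
  have cont: "(+) t \<in> borel_measurable borel" for t :: "'p padic_int"
  proof (rule borel_measurable_continuous_onI)
    show "continuous_on UNIV ((+) t)"
      by (auto simp: continuous_on_iff dist_padic_int_def)
  qed
  have inv: "distr M borel ((+) t) = M" for t :: "'p padic_int"
  proof (rule padic_measure_eqI[symmetric])
    fix n c assume c: "c \<in> {0..<?p ^ n}"
    have "(+) t -` residue_class n c = (+) (- t) ` residue_class n c"
      by (auto intro!: image_eqI[of _ _ "t + _"])
    also have "\<dots> = residue_class n ((padic_residue (- t) n + c) mod ?p ^ n)"
      using c by (simp only: image_plus_residue_class if_True)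
    finally have "emeasure (distr M borel ((+) t)) (residue_class n c) =
        emeasure M (residue_class n ((padic_residue (- t) n + c) mod ?p ^ n))"
      using cont setsM
      by (subst emeasure_distr) (auto simp: open_residue_class M_def space_borel cong: measurable_cong_sets)
    also have "\<dots> = emeasure M (residue_class n c)"
      using M c p by simp
    finally show "emeasure M (residue_class n c) = emeasure (distr M borel ((+) t)) (residue_class n c)" ..
  qed (simp_all add: setsM one)
  have "emeasure M ((+) t ` A) = emeasure M A" if A: "A \<in> sets borel" for t A
  proof -
    have "(+) t ` A = (+) (- t) -` A"
      by (auto intro!: image_eqI[of _ _ "- t + _"])
    moreover have "emeasure (distr M borel ((+) (- t))) A = emeasure M ((+) (- t) -` A)"
      using cont A by (subst emeasure_distr) (auto simp: M_def)
    ultimately show ?thesis by (simp add: inv)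
  qed
  with setsM one show ?thesis unfolding normalized_haar_def by blast
qed

lemma normalized_haar_haar: "normalized_haar (haar :: 'p::prime_card padic_int measure)"
proof -
  have "\<exists>!M :: 'p padic_int measure. normalized_haar M"
  proof (rule ex_ex1I[OF normalized_haar_exists])
    fix M N :: "'p padic_int measure"
    assume "normalized_haar M" "normalized_haar N"
    then show "M = N"
      by (intro padic_measure_eqI) (auto simp: normalized_haar_def emeasure_haar_residue_class)
  qed
  then show ?thesis unfolding haar_def by (rule theI')
qed


section \<open>Ergodicity on spheres\<close>

definition measure_preserving_map :: "'a measure \<Rightarrow> ('a \<Rightarrow> 'a) \<Rightarrow> bool" where
  "measure_preserving_map M f \<longleftrightarrow> f \<in> measurable M M \<and>
     (\<forall>A\<in>sets M. emeasure M (f -` A \<inter> space M) = emeasure M A)"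

definition ergodic_map :: "'a measure \<Rightarrow> ('a \<Rightarrow> 'a) \<Rightarrow> bool" where
  "ergodic_map M f \<longleftrightarrow> measure_preserving_map M f \<and>
     (\<forall>A\<in>sets M. f -` A \<inter> space M = A \<longrightarrow> emeasure M A \<in> {0, 1})"

definition padic_sphere :: "'p::prime_card padic_int \<Rightarrow> nat \<Rightarrow> 'p padic_int set" where
  "padic_sphere y r = sphere y (1 / real CARD('p) ^ r)"

definition sphere_measure :: "'p::prime_card padic_int \<Rightarrow> nat \<Rightarrow> 'p padic_int measure" where
  "sphere_measure y r =
     scale_measure (1 / emeasure haar (padic_sphere y r)) (restrict_space haar (padic_sphere y r))"

definition ergodic_on_sphere ::
    "('p::prime_card padic_int \<Rightarrow> 'p padic_int) \<Rightarrow> 'p padic_int \<Rightarrow> nat \<Rightarrow> bool" where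
  "ergodic_on_sphere f y r \<longleftrightarrow>
     f ` padic_sphere y r \<subseteq> padic_sphere y r \<and> ergodic_map (sphere_measure y r) f"


section \<open>Generators of the group of units modulo n\<close>

text \<open>The carrier of the residue ring modulo \<open>n\<close> is \<open>{0..n - 1}\<close>, hence the reduction of \<open>a\<close>.\<close>

definition generates_units_mod :: "int \<Rightarrow> int \<Rightarrow> bool" where
  "generates_units_mod n a \<longleftrightarrow>
     generate (units_of (residue_ring n)) {a mod n} = carrier (units_of (residue_ring n))"

end

(*
  Write d = f'(y). On the ball of radius p^-r around y the function f is affine with slope d up
  to an error that is r digits smaller than the increment of the argument.

  If f is ergodic on the sphere of radius p^-r around the fixed point y, then multiplication by d
  permutes the leading digits of z - y. For r >= k the points y + p^r u with u congruent to a power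
  of d modulo p^k form an invariant set that is open and closed, so it is the whole sphere and d
  generates the units modulo p^k. With k = 2 this is the condition in (a); for p = 2 it is absurd
  with k = 3, as the group of units modulo 8 is not cyclic.

  Conversely, ergodicity follows when f is isometric on the sphere and acts transitively on its
  residues modulo every power of p: a measure that gives the same mass to all balls of equal radius
  in the sphere is a multiple of the Haar measure, and for an invariant set A this applies to
  B |-> mu(A Int B). Transitivity is lifted one digit at a time: the iterate of order
  phi(p^n) moves every point of the sphere by exactly p^-(r+n), so its powers run through
  all p lifts of a residue. For n = 2 the displacement is that of multiplication by
  d^phi(p^2), which is not 1 modulo p^3 since p is odd.
*)

theory Submission
  imports Defs "HOL-Number_Theory.Residue_Primitive_Roots"
begin

section \<open>The p-adic norm, units and spheres in terms of divisibility\<close>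

section \<open>Divisibility by powers of p\<close>

text \<open>The uniformizer. From here on norm estimates are phrased as divisibility by its powers,
  so that the calculus of \<open>dvd\<close> replaces the ultrametric inequality.\<close>

definition padic_p :: "'p::prime_card padic_int" where
  "padic_p = of_nat CARD('p)"

lemma padic_residue_p_power:
  "padic_residue (padic_p ^ k :: 'p::prime_card padic_int) n = int CARD('p) ^ k mod int CARD('p) ^ n"
  using padic_residue_of_nat[where 'p='p, of "CARD('p) ^ k" n] by (simp add: padic_p_def)

lemma p_power_dvd_iff:
  fixes x :: "'p::prime_card padic_int"
  shows "padic_p ^ n dvd x \<longleftrightarrow> padic_residue x n = 0"
proof
  assume "padic_p ^ n dvd x"
  then show "padic_residue x n = 0"
    by (auto simp: dvd_def padic_residue_simps padic_residue_p_power)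
next
  assume x: "padic_residue x n = 0"
  let ?p = "int CARD('p)"
  have p: "?p > 0" using CARD_prime_ge_2[where 'p='p] by linarith
  \<comment> \<open>The quotient of \<open>x\<close> by p^n: dividing costs n digits, so its residue
    at level k is read off from level n + k of \<open>x\<close>.\<close>
  define q where "q = (\<lambda>k. padic_residue x (n + k) div ?p ^ n)"
  have qp: "padic_residue x (n + k) = ?p ^ n * q k" for k
    using padic_residue_mod[of n "n + k" x] x by (auto simp: q_def)
  have q: "q k \<in> {0..<?p ^ k} \<and> q (Suc k) mod ?p ^ k = q k" for k
  proof
    have "?p ^ n * 0 \<le> ?p ^ n * q k" "?p ^ n * q k < ?p ^ n * ?p ^ k"
      using padic_residue_bounds[of x "n + k"] by (simp_all add: qp power_add)
    moreover have "?p ^ n > 0" using p by simp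
    ultimately show "q k \<in> {0..<?p ^ k}"
      using p by (simp add: zero_le_mult_iff not_le)
    have "(?p ^ n * q (Suc k)) mod (?p ^ n * ?p ^ k) = ?p ^ n * q k"
      using padic_residue_mod[of "n + k" "n + Suc k" x] by (simp only: qp power_add)
    then show "q (Suc k) mod ?p ^ k = q k"
      using p by (simp add: mod_mult_mult1)
  qed
  then have rep: "padic_residue (Abs_padic_int q :: 'p padic_int) = q"
    by (intro Abs_padic_int_inverse) auto
  have "x = padic_p ^ n * (Abs_padic_int q :: 'p padic_int)"
  proof (rule padic_int_eqI)
    fix k
    have "padic_residue x k = padic_residue x (n + k) mod ?p ^ k"
      by (simp add: padic_residue_mod)
    also have "\<dots> = padic_residue (padic_p ^ n * (Abs_padic_int q :: 'p padic_int)) k"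
      by (simp only: qp times_padic_int.rep_eq padic_residue_p_power rep mod_mult_left_eq)
    finally show "padic_residue x k = padic_residue (padic_p ^ n * (Abs_padic_int q :: 'p padic_int)) k" .
  qed
  then show "padic_p ^ n dvd x" by simp
qed

lemma p_power_dvd_diff_iff:
  fixes x y :: "'p::prime_card padic_int"
  shows "padic_p ^ n dvd x - y \<longleftrightarrow> padic_residue x n = padic_residue y n"
  by (simp add: p_power_dvd_iff padic_residue_diff_eq_0_iff)

lemma padic_norm_le_iff_dvd:
  fixes x :: "'p::prime_card padic_int"
  shows "padic_norm x \<le> 1 / real CARD('p) ^ n \<longleftrightarrow> padic_p ^ n dvd x"
  by (simp add: p_power_dvd_iff padic_norm_le_iff)

lemma p_power_dvd_p_power_mult_iff:
  fixes x :: "'p::prime_card padic_int"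
  shows "padic_p ^ (n + k) dvd padic_p ^ n * x \<longleftrightarrow> padic_p ^ k dvd x"
  using padic_norm_mult_p_power_le_iff[of x n k]
  by (simp add: padic_norm_le_iff_dvd padic_p_def ac_simps)

lemma padic_residue_power:
  fixes x :: "'p::prime_card padic_int"
  shows "padic_residue (x ^ k) n = padic_residue x n ^ k mod int CARD('p) ^ n"
  by (induction k) (simp_all add: padic_residue_simps mod_simps)

lemma coprime_padic_residue_iff:
  fixes u :: "'p::prime_card padic_int"
  assumes "n > 0"
  shows "coprime (padic_residue u n) (int CARD('p)) \<longleftrightarrow> \<not> padic_p dvd u"
proof -
  have pr: "prime (int CARD('p))" using prime_card[where 'a='p] by simp
  have "padic_residue u n mod int CARD('p) = padic_residue u 1"
    using padic_residue_mod[of 1 n u] assms by simp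
  then have "int CARD('p) dvd padic_residue u n \<longleftrightarrow> padic_p dvd u"
    using p_power_dvd_iff[of 1 u] by (simp add: dvd_eq_mod_eq_0)
  moreover have "coprime (padic_residue u n) (int CARD('p)) \<longleftrightarrow> \<not> int CARD('p) dvd padic_residue u n"
    using prime_imp_coprime[OF pr] pr coprime_common_divisor[of "padic_residue u n" "int CARD('p)" "int CARD('p)"]
    by (auto simp: coprime_commute)
  ultimately show ?thesis by blast
qed

text \<open>Units are expressed throughout as elements not divisible by \<open>padic_p\<close>,
  which avoids inverses. The residue of such an element is coprime to p^n and cancels.\<close>

lemma p_power_dvd_unit_mult_iff:
  fixes u x :: "'p::prime_card padic_int"
  assumes "\<not> padic_p dvd u"
  shows "padic_p ^ n dvd u * x \<longleftrightarrow> padic_p ^ n dvd x"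
proof (cases "n = 0")
  case False
  then have "coprime (padic_residue u n) (int CARD('p))"
    using assms by (simp add: coprime_padic_residue_iff)
  then have "coprime (int CARD('p) ^ n) (padic_residue u n)"
    by (simp add: coprime_commute)
  then have "int CARD('p) ^ n dvd padic_residue u n * padic_residue x n \<longleftrightarrow>
      int CARD('p) ^ n dvd padic_residue x n"
    by (rule coprime_dvd_mult_right_iff)
  then show ?thesis
    by (simp add: p_power_dvd_iff times_padic_int.rep_eq dvd_eq_mod_eq_0)
qed simp

lemma not_p_dvd_mult:
  fixes u v :: "'p::prime_card padic_int"
  assumes "\<not> padic_p dvd u" "\<not> padic_p dvd v"
  shows "\<not> padic_p dvd u * v"
  using p_power_dvd_unit_mult_iff[OF assms(1), of 1 v] assms(2) by simp

lemma not_p_dvd_1: "\<not> (padic_p :: 'p::prime_card padic_int) dvd 1"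
  using p_power_dvd_iff[of 1 "1 :: 'p padic_int"] CARD_prime_ge_2[where 'p='p]
  by (simp add: one_padic_int.rep_eq)

lemma not_p_dvd_power:
  fixes u :: "'p::prime_card padic_int"
  assumes "\<not> padic_p dvd u"
  shows "\<not> padic_p dvd u ^ n"
  by (induction n) (simp_all add: not_p_dvd_1 not_p_dvd_mult assms)

lemma p_power_dvd_lower:
  fixes x :: "'p::prime_card padic_int"
  assumes "padic_p ^ n dvd x" "m \<le> n"
  shows "padic_p ^ m dvd x"
  using assms le_imp_power_dvd dvd_trans by blast

text \<open>The norm takes only the values 0 and p^-n, so it equals p^-r exactly when it is at most
  p^-r but not at most p^-(r+1).\<close>

lemma mem_padic_sphere_iff:
  fixes y z :: "'p::prime_card padic_int"
  shows "z \<in> padic_sphere y r \<longleftrightarrow> padic_p ^ r dvd z - y \<and> \<not> padic_p ^ Suc r dvd z - y"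
proof -
  let ?p = "real CARD('p)"
  have p: "?p > 1" using CARD_prime_ge_2[where 'p='p] by linarith
  have "padic_norm (z - y) = 1 / ?p ^ r \<longleftrightarrow>
      padic_norm (z - y) \<le> 1 / ?p ^ r \<and> \<not> padic_norm (z - y) \<le> 1 / ?p ^ Suc r"
    (is "?L \<longleftrightarrow> ?R")
  proof
    assume ?L
    have "(1 / ?p) ^ Suc r < (1 / ?p) ^ r"
      using p by (intro power_strict_decreasing) auto
    then show ?R using \<open>?L\<close> by (simp only: power_one_over order_refl not_le)
  next
    assume R: ?R
    from padic_norm_cases[of "z - y"] show ?L
    proof
      assume "padic_norm (z - y) = 0"
      with R p show ?L by simp
    next
      assume "\<exists>n. padic_norm (z - y) = 1 / ?p ^ n"
      then obtain n where n: "padic_norm (z - y) = 1 / ?p ^ n" ..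
      have "r \<le> n" "\<not> Suc r \<le> n"
        using R p unfolding n by (simp_all add: field_simps flip: power_Suc)
      then have "n = r" by simp
      then show ?L using n by simp
    qed
  qed
  moreover have "z \<in> padic_sphere y r \<longleftrightarrow> padic_norm (z - y) = 1 / ?p ^ r"
    unfolding padic_sphere_def mem_sphere dist_commute[of y] by (simp only: dist_padic_int_def)
  ultimately show ?thesis by (simp only: padic_norm_le_iff_dvd)
qed

text \<open>Parametrizes the sphere by units; the leading digits of \<open>u\<close> are the ones on
  which the derivative at the centre acts.\<close>

lemma mem_padic_sphere_iff_unit:
  fixes y u :: "'p::prime_card padic_int"
  shows "y + padic_p ^ r * u \<in> padic_sphere y r \<longleftrightarrow> \<not> padic_p dvd u"
  using p_power_dvd_p_power_mult_iff[of r 1 u] by (simp add: mem_padic_sphere_iff)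

section \<open>Completeness, and linear approximation of power series with integral
  coefficients\<close>

section \<open>Convergence and power series\<close>

lemma padic_tendsto_dvd:
  fixes X :: "nat \<Rightarrow> 'p::prime_card padic_int"
  assumes "X \<longlonglongrightarrow> L"
  shows "eventually (\<lambda>i. padic_p ^ n dvd X i - L) sequentially"
proof -
  have "0 < 1 / real CARD('p) ^ n" using CARD_prime_ge_2[where 'p='p] by simp
  from tendstoD[OF assms this] show ?thesis
    by (rule eventually_mono) (simp add: dist_padic_int_def flip: padic_norm_le_iff_dvd)
qed

text \<open>In an ultrametric space it suffices that consecutive differences tend to 0: then every
  residue is eventually constant, and the eventual values form the limit.\<close>

lemma padic_complete:
  fixes X :: "nat \<Rightarrow> 'p::prime_card padic_int"
  assumes "\<And>n. eventually (\<lambda>i. padic_p ^ n dvd X (Suc i) - X i) sequentially"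
  shows "\<exists>L. \<forall>n. eventually (\<lambda>i. padic_p ^ n dvd X i - L) sequentially"
proof -
  let ?p = "int CARD('p)"
  have "\<exists>N. \<forall>i\<ge>N. padic_residue (X i) n = padic_residue (X N) n" for n
  proof -
    from assms[of n] obtain N where
      N: "\<And>i. i \<ge> N \<Longrightarrow> padic_residue (X (Suc i)) n = padic_residue (X i) n"
      by (auto simp: eventually_sequentially p_power_dvd_diff_iff)
    have "padic_residue (X i) n = padic_residue (X N) n" if "i \<ge> N" for i
      using that
      by (induction i rule: dec_induct) (simp_all add: N)
    then show ?thesis by blast
  qed
  then obtain N where N: "\<And>n i. i \<ge> N n \<Longrightarrow> padic_residue (X i) n = padic_residue (X (N n)) n"
    by metis
  define q where "q n = padic_residue (X (N n)) n" for n
  have "q n \<in> {0..<?p ^ n} \<and> q (Suc n) mod ?p ^ n = q n" for n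
  proof
    \<comment> \<open>An index at which the residues of both levels have stabilized, so that their
      compatibility can be read off from a single term.\<close>
    let ?M = "max (N n) (N (Suc n))"
    show "q n \<in> {0..<?p ^ n}" by (simp add: q_def padic_residue_bounds)
    have "padic_residue (X ?M) (Suc n) = q (Suc n)" "padic_residue (X ?M) n = q n"
      unfolding q_def by (rule N; simp)+
    then show "q (Suc n) mod ?p ^ n = q n"
      using padic_residue_mod[of n "Suc n" "X ?M"] by simp
  qed
  then have rep: "padic_residue (Abs_padic_int q :: 'p padic_int) = q"
    by (intro Abs_padic_int_inverse) auto
  have "\<forall>i\<ge>N n. padic_p ^ n dvd X i - Abs_padic_int q" for n
    unfolding p_power_dvd_diff_iff rep q_def using N by blast
  then show ?thesis unfolding eventually_sequentially by blast
qed

text \<open>Factor out z - z'; modulo \<open>m\<close> both points equal y, so the cofactor is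
  congruent to the derivative of the i-th power at y. For i = 0 the factor \<open>of_nat i\<close>
  makes the truncated exponent harmless.\<close>

lemma power_diff_dvd_linear:
  fixes y z z' :: "'a::comm_ring_1"
  assumes "m dvd z - y" "m dvd z' - y" "n dvd z - z'"
  shows "n * m dvd z ^ i - z' ^ i - of_nat i * y ^ (i - 1) * (z - z')"
proof -
  have "m dvd (\<Sum>j<i. z ^ j * z' ^ (i - Suc j)) - of_nat i * y ^ (i - 1)"
  proof -
    have "of_nat i * y ^ (i - 1) = (\<Sum>j<i. y ^ j * y ^ (i - Suc j))"
      by (simp flip: power_add)
    moreover have "m dvd z ^ j * z' ^ k - y ^ j * y ^ k" for j k
    proof -
      have "m dvd z ^ j - y ^ j" "m dvd z' ^ k - y ^ k"
        using assms(1,2) by (simp_all only: power_diff_sumr2 dvd_mult2)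
      moreover have "z ^ j * z' ^ k - y ^ j * y ^ k =
          (z ^ j - y ^ j) * z' ^ k + y ^ j * (z' ^ k - y ^ k)"
        by (simp add: algebra_simps)
      ultimately show ?thesis by simp
    qed
    ultimately show ?thesis
      by (auto simp flip: sum_subtractf intro!: dvd_sum)
  qed
  moreover have "z ^ i - z' ^ i - of_nat i * y ^ (i - 1) * (z - z') =
      (z - z') * ((\<Sum>j<i. z ^ j * z' ^ (i - Suc j)) - of_nat i * y ^ (i - 1))"
    using power_diff_sumr2[of z i z'] by (simp add: algebra_simps)
  ultimately show ?thesis using assms(3) by (simp add: mult_dvd_mono)
qed

text \<open>The estimate for single powers is uniform in the degree, so it passes to partial sums
  and to the limit. The witness is the value at y of the formal derivative; it serves all r, n, z
  and z' at once.\<close>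

lemma C_function_linear_approx_exists:
  fixes f :: "'p::prime_card padic_int \<Rightarrow> 'p padic_int"
  assumes "C_function f"
  shows "\<exists>d. \<forall>r n z z'. padic_p ^ r dvd z - y \<longrightarrow> padic_p ^ r dvd z' - y \<longrightarrow> padic_p ^ n dvd z - z' \<longrightarrow>
    padic_p ^ (n + r) dvd f z - f z' - d * (z - z')"
proof -
  from assms obtain a where a: "\<And>x. (\<lambda>i. a i * x ^ i) sums f x"
    by (auto simp: C_function_def)
  define S where "S x N = (\<Sum>i<N. a i * x ^ i)" for x N
  define T where "T N = (\<Sum>i<N. a i * (of_nat i * y ^ (i - 1)))" for N
  have S: "eventually (\<lambda>N. padic_p ^ n dvd S x N - f x) sequentially" for x n
    using a[of x] unfolding sums_def S_def by (rule padic_tendsto_dvd)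
  have "eventually (\<lambda>N. padic_p ^ n dvd T (Suc N) - T N) sequentially" for n
  proof -
    \<comment> \<open>Convergence at the point 1 forces the coefficients to tend to 0; hence the
      partial sums \<open>T\<close> of the formal derivative converge as well.\<close>
    have "eventually (\<lambda>N. padic_p ^ n dvd S 1 (Suc N) - f 1) sequentially"
      using S[of n 1] eventually_sequentially_Suc[of "\<lambda>N. padic_p ^ n dvd S 1 N - f 1"] by blast
    with S[of n 1] show ?thesis
    proof eventually_elim
      case (elim N)
      then have "padic_p ^ n dvd (S 1 (Suc N) - f 1) - (S 1 N - f 1)"
        by (rule dvd_diff[rotated])
      also have "(S 1 (Suc N) - f 1) - (S 1 N - f 1) = a N"
        by (simp add: S_def)
      finally show ?case by (simp add: T_def)
    qed
  qed
  then obtain d where d: "\<And>n. eventually (\<lambda>N. padic_p ^ n dvd T N - d) sequentially"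
    using padic_complete by blast
  have "padic_p ^ (n + r) dvd f z - f z' - d * (z - z')"
    if *: "padic_p ^ r dvd z - y" "padic_p ^ r dvd z' - y" "padic_p ^ n dvd z - z'" for r n z z'
  proof -
    have "eventually (\<lambda>N. padic_p ^ (n + r) dvd S z N - f z \<and> padic_p ^ (n + r) dvd S z' N - f z' \<and>
        padic_p ^ (n + r) dvd T N - d) sequentially"
      using S d by (auto intro!: eventually_conj)
    then obtain N where N: "padic_p ^ (n + r) dvd S z N - f z" "padic_p ^ (n + r) dvd S z' N - f z'"
        "padic_p ^ (n + r) dvd T N - d"
      by (auto simp: eventually_sequentially)
    have "S z N - S z' N - T N * (z - z') =
        (\<Sum>i<N. a i * (z ^ i - z' ^ i - of_nat i * y ^ (i - 1) * (z - z')))"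
      unfolding S_def T_def sum_distrib_right sum_subtractf[symmetric]
      by (rule sum.cong) (simp_all add: algebra_simps)
    also have "padic_p ^ (n + r) dvd \<dots>"
      unfolding power_add by (intro dvd_sum dvd_mult power_diff_dvd_linear *)
    finally have "padic_p ^ (n + r) dvd (S z N - S z' N - T N * (z - z')) -
        (S z N - f z) + (S z' N - f z') + (T N - d) * (z - z')"
      by (rule dvd_add[OF dvd_add[OF dvd_diff[OF _ N(1)] N(2)] dvd_mult2[OF N(3)]])
    then show ?thesis by (simp add: algebra_simps)
  qed
  then show ?thesis by blast
qed

text \<open>An error quadratic in x - y leaves a difference quotient bounded by the norm of x -
  y.\<close>

lemma has_padic_derivativeI:
  fixes f :: "'p::prime_card padic_int \<Rightarrow> 'p padic_int"
  assumes approx: "\<And>n x. padic_p ^ n dvd x - y \<Longrightarrow> padic_p ^ (n + n) dvd f x - f y - d * (x - y)"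
  shows "has_padic_derivative f d y"
  unfolding has_padic_derivative_def
proof (rule tendstoI)
  fix e :: real assume "e > 0"
  let ?p = "real CARD('p)"
  have p: "?p > 1" using CARD_prime_ge_2[where 'p='p] by linarith
  obtain N where N: "(1 / ?p) ^ N < e"
    using real_arch_pow_inv[of e "1 / ?p"] p \<open>e > 0\<close> by auto
  have *: "padic_norm (f x - f y - d * (x - y)) / padic_norm (x - y) < e"
    if x: "x \<noteq> y" "dist x y < 1 / ?p ^ N" for x
  proof -
    obtain v where v: "padic_norm (x - y) = 1 / ?p ^ v"
      using padic_norm_cases[of "x - y"] x(1) by (auto simp: padic_norm_eq_0_iff)
    have "N \<le> v"
      using x(2) p by (simp add: dist_padic_int_def v field_simps)
    have "padic_p ^ v dvd x - y" using v by (simp flip: padic_norm_le_iff_dvd)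
    then have "padic_norm (f x - f y - d * (x - y)) \<le> 1 / ?p ^ (v + v)"
      using approx by (simp add: padic_norm_le_iff_dvd)
    then have "padic_norm (f x - f y - d * (x - y)) / padic_norm (x - y) \<le> 1 / ?p ^ (v + v) * ?p ^ v"
      unfolding v using p by (simp add: mult_right_mono del: times_divide_eq_left)
    also have "\<dots> = (1 / ?p) ^ v"
      using p by (simp add: power_add power_one_over)
    also have "\<dots> \<le> (1 / ?p) ^ N"
      using \<open>N \<le> v\<close> p by (intro power_decreasing) auto
    finally show ?thesis using N by simp
  qed
  have pos: "1 / ?p ^ N > 0" using p by simp
  show "eventually (\<lambda>x. dist (padic_norm (f x - f y - d * (x - y)) / padic_norm (x - y)) 0 < e) (at y)"
    unfolding eventually_at
    by (rule exI[of _ "1 / ?p ^ N"]) (use pos * in \<open>auto simp: padic_norm_nonneg\<close>)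
qed

text \<open>The case z' = y, r = n of the estimate is quadratic, so by uniqueness of derivatives its
  slope is \<open>padic_deriv f y\<close>.\<close>

lemma C_function_linear_approx:
  fixes f :: "'p::prime_card padic_int \<Rightarrow> 'p padic_int"
  assumes "C_function f" "padic_p ^ r dvd z - y" "padic_p ^ r dvd z' - y" "padic_p ^ n dvd z - z'"
  shows "padic_p ^ (n + r) dvd f z - f z' - padic_deriv f y * (z - z')"
proof -
  from C_function_linear_approx_exists[OF assms(1), of y] obtain d where
    d: "\<And>r n z z'. padic_p ^ r dvd z - y \<Longrightarrow> padic_p ^ r dvd z' - y \<Longrightarrow> padic_p ^ n dvd z - z' \<Longrightarrow>
      padic_p ^ (n + r) dvd f z - f z' - d * (z - z')"
    by blast
  then have "has_padic_derivative f d y"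
    by (intro has_padic_derivativeI) auto
  then have "padic_deriv f y = d" by (rule padic_deriv_eqI)
  then show ?thesis using d assms(2-4) by simp
qed

lemma C_function_dvd:
  fixes f :: "'p::prime_card padic_int \<Rightarrow> 'p padic_int"
  assumes "C_function f" "padic_p ^ n dvd z - z'"
  shows "padic_p ^ n dvd f z - f z'"
proof -
  \<comment> \<open>With r = 0 the two points may be arbitrary, and integrality of the slope already
    gives the Lipschitz bound.\<close>
  have "padic_p ^ (n + 0) dvd f z - f z' - padic_deriv f z * (z - z')"
    by (rule C_function_linear_approx[OF assms(1) _ _ assms(2)]) simp_all
  then have "padic_p ^ n dvd (f z - f z' - padic_deriv f z * (z - z')) + padic_deriv f z * (z - z')"
    using assms(2) by (intro dvd_add dvd_mult) simp_all
  then show ?thesis by simp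
qed

section \<open>Transitive isometries of a sphere are ergodic\<close>

section \<open>A criterion for ergodicity on a sphere\<close>

text \<open>Such a set is a union of residue classes of one level. Applied to \<open>P\<close> and
  to its negation, this shows that the set is both open and closed.\<close>

lemma open_padic_residue_Collect: "open {x :: 'p::prime_card padic_int. P (padic_residue x n)}"
proof -
  have "{x :: 'p padic_int. P (padic_residue x n)} = (\<Union>c\<in>{c. P c}. residue_class n c)"
    by (auto simp: residue_class_def)
  then show ?thesis by (auto intro: open_residue_class)
qed

lemma borel_residue_class [measurable, simp]: "residue_class n c \<in> sets borel"
  by (rule borel_open[OF open_residue_class])

lemma sets_haar [simp, measurable_cong]: "sets (haar :: 'p::prime_card padic_int measure) = sets borel"
  and emeasure_haar_UNIV [simp]: "emeasure (haar :: 'p::prime_card padic_int measure) UNIV = 1"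
  using normalized_haar_haar[where 'p='p] by (simp_all add: normalized_haar_def)

lemma space_haar [simp]: "space (haar :: 'p::prime_card padic_int measure) = UNIV"
  using sets_eq_imp_space_eq[OF sets_haar] by simp

lemma emeasure_haar_ne_top [simp]: "emeasure (haar :: 'p::prime_card padic_int measure) A \<noteq> top_class.top"
  using emeasure_space[of "haar :: 'p padic_int measure" A] by (auto simp: top_unique)

lemma emeasure_haar_residue_class_of:
  fixes x :: "'p::prime_card padic_int"
  shows "emeasure haar (residue_class n (padic_residue x n) :: 'p padic_int set) =
    ennreal (1 / real CARD('p) ^ n)"
  using padic_residue_bounds[of x n]
  by (intro emeasure_haar_residue_class normalized_haar_haar) auto

lemma emeasure_haar_open_pos:
  fixes U :: "'p::prime_card padic_int set"
  assumes "open U" "x \<in> U"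
  shows "emeasure haar U > 0"
proof -
  obtain n where n: "residue_class n (padic_residue x n) \<subseteq> U"
    using residue_class_subset_open[OF assms] by blast
  have "0 < ennreal (1 / real CARD('p) ^ n)"
    using CARD_prime_ge_2[where 'p='p] by simp
  also have "\<dots> \<le> emeasure haar U"
    using emeasure_mono[OF n, of haar] assms(1) by (simp add: emeasure_haar_residue_class_of)
  finally show ?thesis .
qed

lemma residue_class_refine:
  assumes "n \<le> m"
  shows "(residue_class n c :: 'p::prime_card padic_int set) =
    (\<Union>b\<in>{b\<in>{0..<int CARD('p) ^ m}. b mod int CARD('p) ^ n = c}. residue_class m b)"
  using padic_residue_mod[OF assms] padic_residue_bounds[where 'p='p, of _ m]
  by (auto simp: residue_class_def)

text \<open>Coarse classes are finite disjoint unions of fine ones. For a sphere of exponent r only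
  levels above r are convenient, as there each class lies inside the sphere or misses it.\<close>

lemma padic_measure_eqI_fine:
  fixes M N :: "'p::prime_card padic_int measure"
  assumes sets: "sets M = sets borel" "sets N = sets borel" and fin: "emeasure M UNIV \<noteq> \<infinity>"
    and eq: "\<And>n c. n \<ge> K \<Longrightarrow> emeasure M (residue_class n c) = emeasure N (residue_class n c)"
  shows "M = N"
proof (rule measure_eqI_generator_eq[where A = "\<lambda>_. UNIV"])
  show "Int_stable (residue_classes :: 'p padic_int set set)"
    by (rule Int_stable_residue_classes)
  show "emeasure M X = emeasure N X" if X: "X \<in> residue_classes" for X
  proof -
    from X obtain n c where X: "X = residue_class n c" by auto
    define m where "m = max n K"
    define B where "B = {b\<in>{0..<int CARD('p) ^ m}. b mod int CARD('p) ^ n = c}"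
    have B: "finite B" unfolding B_def by (rule finite_subset[of _ "{0..<int CARD('p) ^ m}"]) auto
    have XB: "X = (\<Union>b\<in>B. residue_class m b)"
      unfolding X B_def by (rule residue_class_refine) (simp add: m_def)
    have sub: "residue_class m ` B \<subseteq> sets M" "residue_class m ` B \<subseteq> sets N"
      by (auto simp: sets)
    have disj: "disjoint_family_on (residue_class m :: int \<Rightarrow> 'p padic_int set) B"
      by (auto simp: disjoint_family_on_def residue_class_def)
    have "emeasure M X = (\<Sum>b\<in>B. emeasure M (residue_class m b))"
      unfolding XB by (rule sum_emeasure[symmetric, OF sub(1) disj B])
    also have "\<dots> = (\<Sum>b\<in>B. emeasure N (residue_class m b))"
      by (rule sum.cong) (simp_all add: eq m_def)
    also have "\<dots> = emeasure N X"
      unfolding XB by (rule sum_emeasure[OF sub(2) disj B])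
    finally show ?thesis .
  qed
  have "residue_class 0 0 = (UNIV :: 'p padic_int set)"
  proof -
    have "padic_residue x 0 = 0" for x :: "'p padic_int"
      using padic_residue_bounds[of x 0] by simp
    then show ?thesis by (simp add: residue_class_def)
  qed
  then have "UNIV \<in> (residue_classes :: 'p padic_int set set)"
    by (auto intro!: image_eqI[of _ _ "(0, 0)"])
  then show "range (\<lambda>_. UNIV) \<subseteq> (residue_classes :: 'p padic_int set set)"
    by blast
qed (use sets fin in \<open>auto simp: sets_borel_padic\<close>)

text \<open>Membership depends only on the residue modulo p^(r+1), hence the strict inequality
  between r and n.\<close>

lemma padic_sphere_cong:
  fixes y z z' :: "'p::prime_card padic_int"
  assumes "z \<in> padic_sphere y r" "padic_p ^ n dvd z' - z" "r < n"
  shows "z' \<in> padic_sphere y r"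
proof -
  have *: "padic_p ^ m dvd z' - y \<longleftrightarrow> padic_p ^ m dvd z - y" if "m \<le> n" for m
    using dvd_add_right_iff[of "padic_p ^ m" "z' - z" "z - y"] p_power_dvd_lower[OF assms(2) that]
    by simp
  show ?thesis
    using assms(1,3) *[of r] *[of "Suc r"] by (simp add: mem_padic_sphere_iff)
qed

lemma open_padic_sphere: "open (padic_sphere y r :: 'p::prime_card padic_int set)"
proof -
  have "padic_sphere y r = {z. \<exists>x\<in>padic_sphere y r. padic_residue z (Suc r) = padic_residue x (Suc r)}"
    using padic_sphere_cong[of _ y r "Suc r"] by (auto simp only: p_power_dvd_diff_iff lessI)
  also have "open \<dots>"
    by (rule open_padic_residue_Collect)
  finally show ?thesis .
qed

lemma borel_padic_sphere [measurable]: "padic_sphere y r \<in> sets borel"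
  by (rule borel_open[OF open_padic_sphere])

lemma base_point_in_padic_sphere:
  "y + padic_p ^ r \<in> (padic_sphere y r :: 'p::prime_card padic_int set)"
  using mem_padic_sphere_iff_unit[of y r 1] not_p_dvd_1 by simp

lemma emeasure_padic_sphere_pos: "emeasure haar (padic_sphere y r :: 'p::prime_card padic_int set) > 0"
  by (rule emeasure_haar_open_pos[OF open_padic_sphere base_point_in_padic_sphere])

lemma space_sphere_measure: "space (sphere_measure y r) = padic_sphere y r"
  by (simp add: sphere_measure_def space_scale_measure space_restrict_space)

lemma sets_sphere_measure_iff:
  "A \<in> sets (sphere_measure y r) \<longleftrightarrow> A \<in> sets borel \<and> A \<subseteq> padic_sphere y r"
  by (auto simp: sphere_measure_def sets_restrict_space_iff)

lemma emeasure_sphere_measure: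
  assumes "A \<in> sets borel" "A \<subseteq> padic_sphere y r"
  shows "emeasure (sphere_measure y r) A = 1 / emeasure haar (padic_sphere y r) * emeasure haar A"
  using assms by (simp add: sphere_measure_def emeasure_restrict_space)

lemma emeasure_sphere_measure_eq_1_iff:
  assumes "A \<in> sets borel" "A \<subseteq> padic_sphere y r"
  shows "emeasure (sphere_measure y r) A = 1 \<longleftrightarrow> emeasure haar A = emeasure haar (padic_sphere y r)"
proof -
  let ?s = "emeasure haar (padic_sphere y r)"
  have s: "?s \<noteq> 0" "?s < \<infinity>"
    using emeasure_padic_sphere_pos[of y r] emeasure_haar_ne_top[of "padic_sphere y r"]
    by (simp_all add: top.not_eq_extremum[symmetric])
  have "1 / ?s * emeasure haar A = 1 \<longleftrightarrow> emeasure haar A = ?s"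
  proof
    assume "1 / ?s * emeasure haar A = 1"
    then have "?s * (1 / ?s * emeasure haar A) = ?s" by simp
    moreover have "?s * (1 / ?s) = 1"
      using s by (simp add: ennreal_times_divide)
    ultimately show "emeasure haar A = ?s" by (simp flip: mult.assoc)
  next
    assume "emeasure haar A = ?s"
    with s show "1 / ?s * emeasure haar A = 1"
      by (simp add: ennreal_times_divide mult.commute)
  qed
  then show ?thesis by (simp add: emeasure_sphere_measure assms)
qed

text \<open>If \<open>A\<close> has the same share in all residue classes inside the sphere, its
  restriction of the Haar measure is proportional to that of the sphere, because both spread their
  mass evenly over these classes.\<close>

lemma haar_Int_proportional:
  fixes A :: "'p::prime_card padic_int set"
  assumes A: "A \<in> sets borel" "A \<subseteq> padic_sphere y r"
    and const: "\<And>n x x'. r < n \<Longrightarrow> x \<in> padic_sphere y r \<Longrightarrow> x' \<in> padic_sphere y r \<Longrightarrow>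
      emeasure haar (A \<inter> residue_class n (padic_residue x n)) =
      emeasure haar (A \<inter> residue_class n (padic_residue x' n))"
    and B: "B \<in> sets borel"
  shows "emeasure haar (padic_sphere y r) * emeasure haar (A \<inter> B) =
    emeasure haar A * emeasure haar (padic_sphere y r \<inter> B)"
proof -
  let ?S = "padic_sphere y r" and ?H = "haar :: 'p padic_int measure"
  \<comment> \<open>Each restriction is scaled by the mass of the other set. The total masses then
    agree without any division, even when \<open>A\<close> is null.\<close>
  define M where "M = scale_measure (emeasure ?H ?S) (density ?H (indicator A))"
  define N where "N = scale_measure (emeasure ?H A) (density ?H (indicator ?S))"
  have M: "emeasure M B = emeasure ?H ?S * emeasure ?H (A \<inter> B)" if "B \<in> sets borel" for B
    unfolding M_def using that A by (simp add: emeasure_restricted)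
  have N: "emeasure N B = emeasure ?H A * emeasure ?H (?S \<inter> B)" if "B \<in> sets borel" for B
    unfolding N_def using that by (simp add: emeasure_restricted)
  have "M = N"
  proof (rule padic_measure_eqI_fine)
    show "sets M = sets borel" "sets N = sets borel" by (simp_all add: M_def N_def)
    show "emeasure M UNIV \<noteq> \<infinity>"
      by (simp add: M ennreal_mult_eq_top_iff)
    fix n c assume n: "Suc r \<le> n"
    \<comment> \<open>The residues occurring on the sphere at level n. Both \<open>A\<close> and the
      sphere have \<open>card C\<close> times the mass of their part in any one of these
      classes.\<close>
    define C where "C = (\<lambda>x. padic_residue x n) ` ?S"
    have "C \<subseteq> {0..<int CARD('p) ^ n}"
      by (auto simp: C_def padic_residue_bounds)
    then have C: "finite C" by (rule finite_subset) simp
    have decomp: "emeasure ?H T = (\<Sum>c\<in>C. emeasure ?H (T \<inter> residue_class n c))"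
      if T: "T \<in> sets borel" "T \<subseteq> ?S" for T
    proof -
      have disj: "disjoint_family_on (\<lambda>c. T \<inter> residue_class n c) C"
        by (auto simp: disjoint_family_on_def residue_class_def)
      have sub: "(\<lambda>c. T \<inter> residue_class n c) ` C \<subseteq> sets ?H"
        using T(1) by auto
      have "T = (\<Union>c\<in>C. T \<inter> residue_class n c)"
        using T(2) by (auto simp: C_def residue_class_def)
      then have "emeasure ?H T = emeasure ?H (\<Union>c\<in>C. T \<inter> residue_class n c)" by simp
      also have "\<dots> = (\<Sum>c\<in>C. emeasure ?H (T \<inter> residue_class n c))"
        by (rule sum_emeasure[symmetric, OF sub disj C])
      finally show ?thesis .
    qed
    have class_S: "?S \<inter> residue_class n (padic_residue x n) = residue_class n (padic_residue x n)"
      if "x \<in> ?S" for x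
      using padic_sphere_cong[OF that] n by (auto simp: residue_class_def p_power_dvd_diff_iff)
    show "emeasure M (residue_class n c) = emeasure N (residue_class n c)"
    proof (cases "c \<in> C")
      case True
      then obtain x where x: "x \<in> ?S" "c = padic_residue x n" by (auto simp: C_def)
      have "emeasure ?H A = of_nat (card C) * emeasure ?H (A \<inter> residue_class n c)"
      proof -
        have "emeasure ?H A = (\<Sum>b\<in>C. emeasure ?H (A \<inter> residue_class n c))"
          unfolding decomp[OF A] using n unfolding C_def x(2)
          by (intro sum.cong refl) (elim imageE, simp only:, rule const, simp_all add: x(1))
        then show ?thesis by simp
      qed
      moreover have "emeasure ?H ?S = of_nat (card C) * emeasure ?H (?S \<inter> residue_class n c)"
      proof -
        have "emeasure ?H ?S = (\<Sum>b\<in>C. emeasure ?H (?S \<inter> residue_class n c))"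
          unfolding decomp[OF borel_padic_sphere order_refl] using x
          by (intro sum.cong refl) (auto simp: C_def class_S emeasure_haar_residue_class_of)
        then show ?thesis by simp
      qed
      ultimately show ?thesis
        by (simp add: M N ac_simps)
    next
      case False
      then have "?S \<inter> residue_class n c = {}"
        by (auto simp: C_def residue_class_def)
      moreover from this A have "A \<inter> residue_class n c = {}" by blast
      ultimately show ?thesis
        by (simp add: M N)
    qed
  qed
  with M[OF B] N[OF B] show ?thesis by simp
qed

text \<open>\<open>lipschitz\<close> and \<open>injective\<close> make \<open>f\<close> an isometry
  on the sphere; \<open>transitive\<close> says that every forward orbit in the sphere is dense in
  it.\<close>

locale transitive_on_sphere =
  fixes f :: "'p::prime_card padic_int \<Rightarrow> 'p padic_int" and y :: "'p padic_int" and r :: nat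
  assumes lipschitz: "padic_p ^ n dvd z - z' \<Longrightarrow> padic_p ^ n dvd f z - f z'"
    and maps_sphere: "z \<in> padic_sphere y r \<Longrightarrow> f z \<in> padic_sphere y r"
    and injective: "z \<in> padic_sphere y r \<Longrightarrow> z' \<in> padic_sphere y r \<Longrightarrow> padic_p ^ n dvd f z - f z' \<Longrightarrow>
      padic_p ^ n dvd z - z'"
    and transitive: "z \<in> padic_sphere y r \<Longrightarrow> z' \<in> padic_sphere y r \<Longrightarrow>
      \<exists>j. padic_p ^ n dvd (f ^^ j) z - z'"
begin

abbreviation "S \<equiv> padic_sphere y r"

lemma borel_measurable_f [measurable]: "f \<in> borel_measurable borel"
proof (rule borel_measurable_continuous_onI)
  have "\<exists>d>0. \<forall>z'. dist z' z < d \<longrightarrow> dist (f z') (f z) < e" if "e > 0" for z e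
  proof -
    let ?p = "real CARD('p)"
    have p: "?p > 1" using CARD_prime_ge_2[where 'p='p] by linarith
    obtain N where N: "(1 / ?p) ^ N < e"
      using real_arch_pow_inv[of e "1 / ?p"] p \<open>e > 0\<close> by auto
    have "dist (f z') (f z) < e" if "dist z' z < 1 / ?p ^ N" for z'
    proof -
      have "padic_p ^ N dvd z' - z"
        using that by (simp add: dist_padic_int_def flip: padic_norm_le_iff_dvd)
      then have "dist (f z') (f z) \<le> 1 / ?p ^ N"
        using lipschitz by (simp add: dist_padic_int_def padic_norm_le_iff_dvd)
      with N show ?thesis by (simp add: power_one_over)
    qed
    moreover have "1 / ?p ^ N > 0" using p by simp
    ultimately show ?thesis by blast
  qed
  then show "continuous_on UNIV f" by (simp add: continuous_on_iff)
qed

lemma iterate_maps_sphere: "z \<in> S \<Longrightarrow> (f ^^ j) z \<in> S"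
  by (induction j) (auto intro: maps_sphere)

text \<open>By isometry the preimage of a class is a class of the same level as soon as it contains
  a point; density of orbits provides the point.\<close>

lemma vimage_residue_class:
  assumes "r < n" "x \<in> S"
  obtains x' :: "'p padic_int" where
    "f -` residue_class n (padic_residue x n) \<inter> S = residue_class n (padic_residue x' n)"
proof -
  \<comment> \<open>The orbit starts at \<open>f x\<close> rather than \<open>x\<close>, which
    guarantees one application of \<open>f\<close>: then \<open>(f ^^ j) x\<close> is mapped to
    \<open>x\<close> up to p^n.\<close>
  obtain j where j: "padic_p ^ n dvd (f ^^ j) (f x) - x"
    using transitive[of "f x" x n] assms maps_sphere by blast
  define x' where "x' = (f ^^ j) x"
  have x': "x' \<in> S" by (simp add: x'_def iterate_maps_sphere assms)
  have fx': "padic_residue (f x') n = padic_residue x n"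
    using j by (simp add: p_power_dvd_diff_iff x'_def funpow_swap1)
  have "f -` residue_class n (padic_residue x n) \<inter> S = residue_class n (padic_residue x' n)"
  proof (intro equalityI subsetI)
    fix z assume "z \<in> f -` residue_class n (padic_residue x n) \<inter> S"
    then show "z \<in> residue_class n (padic_residue x' n)"
      using injective[OF _ x', of z n] fx' by (simp add: residue_class_def p_power_dvd_diff_iff)
  next
    fix z :: "'p padic_int" assume "z \<in> residue_class n (padic_residue x' n)"
    then have "padic_p ^ n dvd z - x'"
      by (simp add: residue_class_def p_power_dvd_diff_iff)
    then show "z \<in> f -` residue_class n (padic_residue x n) \<inter> S"
      using lipschitz[of n z x'] fx' padic_sphere_cong[OF x' _ \<open>r < n\<close>]
      by (simp add: residue_class_def p_power_dvd_diff_iff)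
  qed
  then show ?thesis by (rule that)
qed

text \<open>The push-forward and the original restriction to the sphere are compared on classes of
  level above r: a class in the sphere pulls back to a class of equal mass, any other class to the
  empty set.\<close>

lemma haar_vimage:
  assumes B: "B \<in> sets borel"
  shows "emeasure haar (f -` B \<inter> S) = emeasure haar (S \<inter> B)"
proof -
  let ?H = "haar :: 'p padic_int measure"
  define N where "N = density ?H (indicator S)"
  define M where "M = distr N borel f"
  have f: "f \<in> measurable N borel"
    by (simp add: N_def)
  have vim: "f -` B \<in> sets borel" if "B \<in> sets borel" for B
    using measurable_sets[OF borel_measurable_f that] by simp
  have M: "emeasure M B = emeasure ?H (f -` B \<inter> S)" if "B \<in> sets borel" for B
    unfolding M_def using that f vim[OF that]
    by (subst emeasure_distr) (auto simp: N_def emeasure_restricted Int_commute)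
  have N: "emeasure N B = emeasure ?H (S \<inter> B)" if "B \<in> sets borel" for B
    unfolding N_def using that by (simp add: emeasure_restricted)
  have "M = N"
  proof (rule padic_measure_eqI_fine)
    show "sets M = sets borel" "sets N = sets borel" by (simp_all add: M_def N_def)
    show "emeasure M UNIV \<noteq> \<infinity>" by (simp add: M)
    fix n c assume n: "Suc r \<le> n"
    show "emeasure M (residue_class n c) = emeasure N (residue_class n c)"
    proof (cases "\<exists>x\<in>S. c = padic_residue x n")
      case True
      then obtain x where x: "x \<in> S" "c = padic_residue x n" by blast
      from vimage_residue_class[OF Suc_le_lessD[OF n] x(1)] obtain x' :: "'p padic_int" where
        "f -` residue_class n (padic_residue x n) \<inter> S = residue_class n (padic_residue x' n)" .
      moreover have "S \<inter> residue_class n c = residue_class n c"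
        using padic_sphere_cong[OF x(1)] n unfolding x(2) by (auto simp: residue_class_def p_power_dvd_diff_iff)
      ultimately show ?thesis
        unfolding x(2) by (simp add: M N emeasure_haar_residue_class_of x(1))
    next
      case False
      then have "S \<inter> residue_class n c = {}" "f -` residue_class n c \<inter> S = {}"
        using maps_sphere by (auto simp: residue_class_def)
      then show ?thesis by (simp add: M N)
    qed
  qed
  with M[OF B] N[OF B] show ?thesis by simp
qed

lemma measure_preserving: "measure_preserving_map (sphere_measure y r) f"
  unfolding measure_preserving_map_def space_sphere_measure
proof (intro conjI ballI)
  have vim: "f -` A \<inter> S \<in> sets borel" if "A \<in> sets borel" for A
    using measurable_sets[OF borel_measurable_f that] by (intro sets.Int) auto
  show "f \<in> measurable (sphere_measure y r) (sphere_measure y r)"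
    by (rule measurableI) (auto simp: space_sphere_measure sets_sphere_measure_iff maps_sphere vim)
  fix A assume "A \<in> sets (sphere_measure y r)"
  then have A: "A \<in> sets borel" "A \<subseteq> S" by (simp_all add: sets_sphere_measure_iff)
  then have "S \<inter> A = A" by blast
  with A show "emeasure (sphere_measure y r) (f -` A \<inter> S) = emeasure (sphere_measure y r) A"
    by (simp add: emeasure_sphere_measure vim haar_vimage)
qed

text \<open>The share of an invariant set in the class of x does not change along orbits, so by
  transitivity it is constant on the sphere. Proportionality, tested on \<open>A\<close> itself,
  gives mu(A) mu(S) = mu(A)^2.\<close>

lemma invariant_set_trivial:
  assumes A: "A \<in> sets borel" "A \<subseteq> S" and inv: "f -` A \<inter> S = A"
  shows "emeasure haar A = 0 \<or> emeasure haar A = emeasure haar S"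
proof -
  let ?H = "haar :: 'p padic_int measure"
  let ?c = "\<lambda>n x. residue_class n (padic_residue x n)"
  have step: "emeasure ?H (A \<inter> ?c n (f x)) = emeasure ?H (A \<inter> ?c n x)" if "r < n" "x \<in> S" for n x
  proof -
    have "f z \<in> ?c n (f x) \<longleftrightarrow> z \<in> ?c n x" if "z \<in> S" for z
      using injective[OF that \<open>x \<in> S\<close>, of n] lipschitz[of n z x]
      by (auto simp: residue_class_def p_power_dvd_diff_iff)
    then have "f -` (A \<inter> ?c n (f x)) \<inter> S = A \<inter> ?c n x"
      using inv A by auto
    moreover have "S \<inter> (A \<inter> ?c n (f x)) = A \<inter> ?c n (f x)"
      using A by blast
    ultimately show ?thesis
      using haar_vimage[of "A \<inter> ?c n (f x)"] A(1) by simp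
  qed
  have iter: "emeasure ?H (A \<inter> ?c n ((f ^^ j) x)) = emeasure ?H (A \<inter> ?c n x)"
    if "r < n" "x \<in> S" for n x j
    by (induction j) (simp_all add: step iterate_maps_sphere that)
  have "emeasure ?H (A \<inter> ?c n x) = emeasure ?H (A \<inter> ?c n x')"
    if n: "r < n" and x: "x \<in> S" and x': "x' \<in> S" for n x x'
  proof -
    obtain j where "padic_residue ((f ^^ j) x) n = padic_residue x' n"
      using transitive[OF x x', of n] by (auto simp: p_power_dvd_diff_iff)
    with iter[OF n x, of j] show ?thesis by simp
  qed
  then have "emeasure ?H S * emeasure ?H (A \<inter> A) = emeasure ?H A * emeasure ?H (S \<inter> A)"
    by (intro haar_Int_proportional A)
  moreover have "S \<inter> A = A" using A by blast
  ultimately have "emeasure ?H A * emeasure ?H S = emeasure ?H A * emeasure ?H A"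
    by (simp add: mult.commute)
  then show ?thesis
    using emeasure_haar_ne_top[of A] by (auto simp: ennreal_mult_cancel_left)
qed

theorem ergodic: "ergodic_on_sphere f y r"
  unfolding ergodic_on_sphere_def ergodic_map_def space_sphere_measure
proof (intro conjI ballI impI)
  show "f ` S \<subseteq> S" using maps_sphere by blast
  show "measure_preserving_map (sphere_measure y r) f" by (rule measure_preserving)
  fix A assume "A \<in> sets (sphere_measure y r)" and inv: "f -` A \<inter> S = A"
  then have A: "A \<in> sets borel" "A \<subseteq> S" by (simp_all add: sets_sphere_measure_iff)
  from invariant_set_trivial[OF A inv] show "emeasure (sphere_measure y r) A \<in> {0, 1}"
    using emeasure_sphere_measure_eq_1_iff[OF A] by (auto simp: emeasure_sphere_measure A)
qed

end

section \<open>Cyclicity of the units modulo powers of p, and primitive roots\<close>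

section \<open>Generators of the groups of units\<close>

lemma p_power_dvd_of_nat_diff_iff:
  "padic_p ^ n dvd (of_nat a - of_nat b :: 'p::prime_card padic_int) \<longleftrightarrow> [a = b] (mod CARD('p) ^ n)"
  unfolding p_power_dvd_diff_iff padic_residue_of_nat cong_int_iff[symmetric] cong_def by simp

lemma p_power_dvd_diff_of_nat_residue:
  fixes x :: "'p::prime_card padic_int"
  shows "padic_p ^ n dvd x - of_nat (nat (padic_residue x n))"
  using padic_residue_bounds[of x n] unfolding p_power_dvd_diff_iff padic_residue_of_nat by simp

lemma p_dvd_of_nat_iff:
  "padic_p dvd (of_nat a :: 'p::prime_card padic_int) \<longleftrightarrow> CARD('p) dvd a"
  using p_power_dvd_of_nat_diff_iff[where 'p='p, of 1 a 0] by (simp add: cong_0_iff)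

lemma p_dvd_cong:
  fixes x y :: "'p::prime_card padic_int"
  assumes "padic_p ^ n dvd x - y" "n > 0"
  shows "padic_p dvd x \<longleftrightarrow> padic_p dvd y"
proof -
  have "padic_p dvd x - y"
    using p_power_dvd_lower[OF assms(1), of 1] assms(2) by simp
  then show ?thesis using dvd_add_right_iff[of padic_p "x - y" y] by simp
qed

lemma dvd_power_diff:
  fixes x y :: "'a::comm_ring_1"
  assumes "m dvd x - y"
  shows "m dvd x ^ j - y ^ j"
  using assms by (simp only: power_diff_sumr2 dvd_mult2)

lemma dvd_diff_trans:
  fixes x y z :: "'a::comm_ring_1"
  assumes "m dvd x - y" "m dvd y - z"
  shows "m dvd x - z"
  using dvd_add[OF assms] by simp

lemma dvd_diff_sym:
  fixes x y :: "'a::comm_ring_1"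
  assumes "m dvd x - y"
  shows "m dvd y - x"
  using assms by (metis dvd_minus_iff minus_diff_eq)

lemma coprime_CARD_iff: "coprime a (CARD('p::prime_card)) \<longleftrightarrow> \<not> CARD('p) dvd a"
proof
  show "coprime a CARD('p) \<Longrightarrow> \<not> CARD('p) dvd a"
    using not_prime_unit prime_card[where 'a='p] coprime_common_divisor[of a "CARD('p)" "CARD('p)"] by auto
  show "\<not> CARD('p) dvd a \<Longrightarrow> coprime a CARD('p)"
    using prime_imp_coprime[OF prime_card[where 'a='p]] by (simp add: coprime_commute)
qed

text \<open>Euler's theorem for an integer representative. It also supplies inverses: the power of
  \<open>u\<close> with exponent one less inverts \<open>u\<close> modulo p^n.\<close>

lemma padic_euler:
  fixes u :: "'p::prime_card padic_int"
  assumes "\<not> padic_p dvd u"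
  shows "padic_p ^ n dvd u ^ totient (CARD('p) ^ n) - 1"
proof (cases "n = 0")
  case False
  define a where "a = nat (padic_residue u n)"
  have a: "padic_p ^ n dvd u - of_nat a"
    unfolding a_def by (rule p_power_dvd_diff_of_nat_residue)
  with assms False have "\<not> CARD('p) dvd a"
    using p_dvd_cong[OF a] by (simp add: p_dvd_of_nat_iff)
  then have "coprime a (CARD('p) ^ n)" by (simp add: coprime_CARD_iff)
  then have "[a ^ totient (CARD('p) ^ n) = 1] (mod CARD('p) ^ n)" by (rule euler_theorem)
  then have "padic_p ^ n dvd (of_nat a ^ totient (CARD('p) ^ n) - 1 :: 'p padic_int)"
    using p_power_dvd_of_nat_diff_iff[where 'p='p, of n "a ^ totient (CARD('p) ^ n)" 1] by simp
  with dvd_power_diff[OF a] show ?thesis by (rule dvd_diff_trans)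
qed simp

text \<open>Generation of the units modulo p^k, stated for p-adic integers. Natural exponents
  suffice since this group is finite.\<close>

definition generates_padic_units :: "nat \<Rightarrow> 'p::prime_card padic_int \<Rightarrow> bool" where
  "generates_padic_units k d \<longleftrightarrow>
     \<not> padic_p dvd d \<and> (\<forall>u. \<not> padic_p dvd u \<longrightarrow> (\<exists>j. padic_p ^ k dvd d ^ j - u))"

lemma generates_units_mod_iff_powers:
  fixes n a :: int
  assumes "n > 1"
  shows "generates_units_mod n a \<longleftrightarrow> coprime a n \<and> (\<forall>b. coprime b n \<longrightarrow> (\<exists>j. [a ^ j = b] (mod n)))"
proof -
  interpret residues n "residue_ring n" using assms by unfold_locales simp_all
  let ?R = "residue_ring n" and ?U = "units_of (residue_ring n)"
  interpret U: group ?U by (rule units_group)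
  have carrier: "carrier ?U = {x. 0 < x \<and> x < n \<and> coprime x n}"
    by (simp add: units_of_carrier res_units_eq)
  have mod_carrier: "b mod n \<in> carrier ?U \<longleftrightarrow> coprime b n" for b
    using assms mod_in_res_units[of b] by (auto simp: units_of_carrier res_units_eq)
  have "finite (carrier ?U)"
    unfolding carrier by (rule finite_subset[of _ "{0..n}"]) auto
  have "generates_units_mod n a \<longleftrightarrow> (\<forall>b. coprime b n \<longrightarrow> (\<exists>j. [a ^ j = b] (mod n)))" if a: "coprime a n"
  proof -
    have aU: "a mod n \<in> carrier ?U" using a mod_carrier by simp
    \<comment> \<open>Finiteness of the group removes the negative powers.\<close>
    have "generate ?U {a mod n} = {(a mod n) [^]\<^bsub>?U\<^esub> j | j. j \<in> (UNIV :: nat set)}"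
      by (rule U.generate_pow_on_finite_carrier[OF \<open>finite (carrier ?U)\<close> aU])
    also have "\<dots> = range (\<lambda>j. a ^ j mod n)"
      using aU by (auto simp: units_of_pow units_of_carrier pow_cong)
    finally have gen: "generate ?U {a mod n} = range (\<lambda>j. a ^ j mod n)" .
    have "range (\<lambda>j. a ^ j mod n) \<subseteq> carrier ?U"
      using a by (auto simp: mod_carrier simp del: carrier)
    then have "generates_units_mod n a \<longleftrightarrow> carrier ?U \<subseteq> range (\<lambda>j. a ^ j mod n)"
      unfolding generates_units_mod_def gen by blast
    also have "\<dots> \<longleftrightarrow> (\<forall>b. coprime b n \<longrightarrow> (\<exists>j. [a ^ j = b] (mod n)))"
    proof
      assume L: "carrier ?U \<subseteq> range (\<lambda>j. a ^ j mod n)"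
      show "\<forall>b. coprime b n \<longrightarrow> (\<exists>j. [a ^ j = b] (mod n))"
      proof (intro allI impI)
        fix b assume "coprime b n"
        then have "b mod n \<in> range (\<lambda>j. a ^ j mod n)" using L mod_carrier by blast
        then show "\<exists>j. [a ^ j = b] (mod n)" by (auto simp: cong_def)
      qed
    next
      assume R: "\<forall>b. coprime b n \<longrightarrow> (\<exists>j. [a ^ j = b] (mod n))"
      show "carrier ?U \<subseteq> range (\<lambda>j. a ^ j mod n)"
      proof
        fix b assume "b \<in> carrier ?U"
        then have b: "0 < b" "b < n" "coprime b n" by (auto simp: carrier)
        then obtain j where "[a ^ j = b] (mod n)" using R by blast
        with b have "b = a ^ j mod n" by (simp add: cong_def)
        then show "b \<in> range (\<lambda>j. a ^ j mod n)" by blast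
      qed
    qed
    finally show ?thesis .
  qed
  moreover have "coprime a n" if "generates_units_mod n a"
  proof -
    have "a mod n \<in> carrier ?U"
      using that generate.incl[of "a mod n" "{a mod n}" ?U] by (simp add: generates_units_mod_def)
    then show ?thesis by (simp add: mod_carrier del: carrier)
  qed
  ultimately show ?thesis by blast
qed

lemma generates_units_mod_padic_residue_iff:
  fixes d :: "'p::prime_card padic_int"
  assumes "k > 0"
  shows "generates_units_mod (int CARD('p) ^ k) (padic_residue d k) \<longleftrightarrow> generates_padic_units k d"
proof -
  let ?p = "int CARD('p)"
  have "?p ^ k > 1" using CARD_prime_ge_2[where 'p='p] assms by simp
  moreover have "coprime (padic_residue d k) (?p ^ k) \<longleftrightarrow> \<not> padic_p dvd d"
    using assms by (simp add: coprime_padic_residue_iff)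
  moreover have "(\<forall>b. coprime b (?p ^ k) \<longrightarrow> (\<exists>j. [padic_residue d k ^ j = b] (mod ?p ^ k))) \<longleftrightarrow>
      (\<forall>u. \<not> padic_p dvd u \<longrightarrow> (\<exists>j. padic_p ^ k dvd d ^ j - u))" (is "?L \<longleftrightarrow> ?R")
  proof
    assume L: ?L
    show ?R
    proof (intro allI impI)
      fix u :: "'p padic_int" assume "\<not> padic_p dvd u"
      then have "coprime (padic_residue u k) (?p ^ k)"
        using assms by (simp add: coprime_padic_residue_iff)
      with L obtain j where "[padic_residue d k ^ j = padic_residue u k] (mod ?p ^ k)" by blast
      then have "padic_p ^ k dvd d ^ j - u"
        by (simp add: cong_def p_power_dvd_diff_iff padic_residue_power)
      then show "\<exists>j. padic_p ^ k dvd d ^ j - u" ..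
    qed
  next
    assume R: ?R
    show ?L
    proof (intro allI impI)
      fix b assume b: "coprime b (?p ^ k)"
      define u :: "'p padic_int" where "u = of_nat (nat (b mod ?p ^ k))"
      have u: "padic_residue u k = b mod ?p ^ k"
        using CARD_prime_ge_2[where 'p='p] by (simp add: u_def padic_residue_of_nat del: of_nat_nat)
      have "coprime (b mod ?p ^ k) (?p ^ k)"
        using b CARD_prime_ge_2[where 'p='p] by (subst coprime_mod_left_iff) auto
      then have "\<not> padic_p dvd u"
        using assms coprime_padic_residue_iff[of k u] by (simp add: u)
      with R obtain j where "padic_p ^ k dvd d ^ j - u" by blast
      then have "[padic_residue d k ^ j = b] (mod ?p ^ k)"
        by (simp add: cong_def p_power_dvd_diff_iff padic_residue_power u)
      then show "\<exists>j. [padic_residue d k ^ j = b] (mod ?p ^ k)" ..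
    qed
  qed
  ultimately show ?thesis
    unfolding generates_padic_units_def by (simp only: generates_units_mod_iff_powers)
qed

text \<open>Exponents may be reduced modulo the order, so at most \<open>ord n a\<close> powers
  cover all \<open>totient n\<close> units; since the order divides the totient, the two
  agree.\<close>

lemma residue_primrootI:
  fixes n a :: nat
  assumes "n > 1" "coprime n a" and cover: "\<And>b. coprime n b \<Longrightarrow> \<exists>j. [a ^ j = b] (mod n)"
  shows "residue_primroot n a"
proof -
  have ord: "ord n a > 0" using assms by simp
  have "totatives n \<subseteq> (\<lambda>k. a ^ k mod n) ` {..<ord n a}"
  proof
    fix b assume b: "b \<in> totatives n"
    then have "coprime n b" "b < n"
      using totatives_less[OF b] assms(1) by (simp_all add: totatives_def coprime_commute)
    then obtain j where j: "[a ^ j = b] (mod n)" using cover by blast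
    have "[a ^ j = a ^ (j mod ord n a)] (mod n)"
      using assms(2) by (simp add: order_divides_expdiff)
    with j \<open>b < n\<close> have "b = a ^ (j mod ord n a) mod n"
      by (metis cong_def mod_less)
    with ord show "b \<in> (\<lambda>k. a ^ k mod n) ` {..<ord n a}" by auto
  qed
  then have "card (totatives n) \<le> card ((\<lambda>k. a ^ k mod n) ` {..<ord n a})"
    by (intro card_mono) auto
  also have "\<dots> \<le> ord n a"
    using card_image_le[of "{..<ord n a}"] by simp
  finally have "totient n \<le> ord n a" by (simp add: totient_def)
  moreover have "ord n a dvd totient n"
    using assms(2) by (intro order_divides_totient)
  ultimately have "ord n a = totient n"
    using assms(1) by (intro antisym) (simp_all add: dvd_imp_le)
  with assms show ?thesis by (simp add: residue_primroot_def)
qed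

lemma generates_padic_units_primroot:
  assumes "generates_padic_units k (of_nat a :: 'p::prime_card padic_int)" "0 < l" "l \<le> k"
  shows "residue_primroot (CARD('p) ^ l) a"
proof (rule residue_primrootI)
  have p: "CARD('p) > 1" using prime_gt_1_nat[OF prime_card[where 'a='p]] .
  show "CARD('p) ^ l > 1" using p assms(2) by (rule one_less_power)
  have "\<not> CARD('p) dvd a"
    using assms(1) p_dvd_of_nat_iff[where 'p='p] by (simp add: generates_padic_units_def)
  then show "coprime (CARD('p) ^ l) a"
    using coprime_CARD_iff[where 'p='p, of a] by (simp add: coprime_commute)
  fix b assume "coprime (CARD('p) ^ l) b"
  then have "\<not> CARD('p) dvd b"
    using coprime_CARD_iff[where 'p='p, of b] assms(2) by (simp add: coprime_commute)
  then obtain j where "padic_p ^ k dvd (of_nat a ^ j - of_nat b :: 'p padic_int)"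
    using assms(1) p_dvd_of_nat_iff[where 'p='p] unfolding generates_padic_units_def by blast
  then have "padic_p ^ l dvd (of_nat (a ^ j) - of_nat b :: 'p padic_int)"
    using p_power_dvd_lower assms(3) by simp
  then show "\<exists>j. [a ^ j = b] (mod CARD('p) ^ l)"
    by (auto simp only: p_power_dvd_of_nat_diff_iff)
qed

lemma generates_padic_units_cong:
  fixes d e :: "'p::prime_card padic_int"
  assumes "generates_padic_units k d" "padic_p ^ k dvd d - e" "0 < k"
  shows "generates_padic_units k e"
  using assms(1) p_dvd_cong[OF assms(2,3)] dvd_diff_trans[OF dvd_power_diff[OF dvd_diff_sym[OF assms(2)]]]
  unfolding generates_padic_units_def by blast

text \<open>A primitive root a modulo p^2 has a^(p-1) different from 1 modulo p^2, and for odd p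
  this non-congruence lifts to the next power. It fixes the exact size of the first displacement
  used for transitivity.\<close>

lemma not_p_cubed_dvd_generator_power:
  fixes d :: "'p::prime_card padic_int"
  assumes "odd CARD('p)" "generates_padic_units 2 d"
  shows "\<not> padic_p ^ 3 dvd d ^ totient (CARD('p) ^ 2) - 1"
proof
  assume dvd: "padic_p ^ 3 dvd d ^ totient (CARD('p) ^ 2) - 1"
  let ?p = "CARD('p)"
  have p: "prime ?p" by (rule prime_card)
  \<comment> \<open>Level 3 rather than 2, as the conclusion is a statement modulo p^3; being a
    generator modulo p^2 is inherited.\<close>
  define a where "a = nat (padic_residue d 3)"
  have a: "padic_p ^ 3 dvd d - of_nat a"
    unfolding a_def by (rule p_power_dvd_diff_of_nat_residue)
  then have "generates_padic_units 2 (of_nat a :: 'p padic_int)"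
    by (intro generates_padic_units_cong[OF assms(2)] p_power_dvd_lower[OF a]) simp_all
  then have "residue_primroot (?p ^ 1) a" and prim2: "residue_primroot (?p ^ 2) a"
    by (rule generates_padic_units_primroot; simp)+
  then have prim: "residue_primroot ?p a" by simp
  have "ord (?p ^ 2) a = ?p * (?p - 1)"
    using prim2 totient_prime_power[OF p, of 2] by (simp add: residue_primroot_def)
  moreover have "\<not> ?p * (?p - 1) dvd ?p - 1"
    using prime_gt_1_nat[OF p] by (auto dest!: dvd_imp_le)
  ultimately have "[a ^ (?p - 1) \<noteq> 1] (mod ?p ^ 2)"
    by (simp only: ord_divides not_False_eq_True)
  then have "[a ^ totient (?p ^ (3 - 1)) \<noteq> 1] (mod ?p ^ 3)"
    by (intro residue_primroot_power_prime_power_neq_1 p assms(1) prim) simp_all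
  moreover have "padic_p ^ 3 dvd (of_nat (a ^ totient (?p ^ 2)) - of_nat 1 :: 'p padic_int)"
    using dvd_diff_trans[OF dvd_power_diff[OF dvd_diff_sym[OF a]] dvd] by simp
  ultimately show False
    unfolding p_power_dvd_of_nat_diff_iff by simp
qed

text \<open>The units modulo 8 have exponent 2 but order 4.\<close>

lemma not_generates_padic_units_mod_8:
  fixes d :: "'p::prime_card padic_int"
  assumes "CARD('p) = 2"
  shows "\<not> generates_padic_units 3 d"
proof
  assume "generates_padic_units 3 d"
  then have "generates_padic_units 3 (of_nat (nat (padic_residue d 3)) :: 'p padic_int)"
    by (rule generates_padic_units_cong[OF _ p_power_dvd_diff_of_nat_residue]) simp
  then have "residue_primroot (2 ^ 3) (nat (padic_residue d 3))"
    using generates_padic_units_primroot[where 'p='p and k=3 and l=3] assms by simp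
  then have "Carmichael (2 ^ 3) = totient (2 ^ 3)" by (rule residue_primroot_Carmichael)
  then show False
    using Carmichael_twopow[of 3] totient_prime_power[of 2 3] by simp
qed

section \<open>Necessity: what ergodicity on small spheres forces at the centre\<close>

section \<open>The derivative at the centre of an ergodic sphere\<close>

text \<open>A unit missed by the powers of d would split the sphere into two nonempty open sets, one
  of them invariant and both of positive measure. The bound \<open>k \<le> r\<close> makes the error
  of the linear approximation vanish modulo p^(r+k).\<close>

lemma ergodic_imp_generates_padic_units:
  fixes f :: "'p::prime_card padic_int \<Rightarrow> 'p padic_int"
  assumes f: "C_function f" "f y = y" and erg: "ergodic_on_sphere f y r" and k: "0 < k" "k \<le> r"
  shows "generates_padic_units k (padic_deriv f y)"
proof -
  define d where "d = padic_deriv f y"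
  let ?S = "padic_sphere y r" and ?H = "haar :: 'p padic_int measure"
  have maps: "f z \<in> ?S" if "z \<in> ?S" for z
    using erg that by (auto simp: ergodic_on_sphere_def)
  have approx: "padic_p ^ m dvd f z - y - d * (z - y)" if "z \<in> ?S" "m \<le> r + r" for z m
    using C_function_linear_approx[OF f(1), of r z y y r] that
    by (intro p_power_dvd_lower[of "r + r" _ m]) (auto simp: f(2) d_def mem_padic_sphere_iff)
  \<comment> \<open>Otherwise \<open>f\<close> would bring y + p^r within p^-(r+1) of y and thus off
    the sphere.\<close>
  have unit: "\<not> padic_p dvd d"
  proof
    assume "padic_p dvd d"
    have S: "y + padic_p ^ r \<in> ?S" by (rule base_point_in_padic_sphere)
    have "padic_p ^ Suc r dvd f (y + padic_p ^ r) - y - d * padic_p ^ r"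
      using approx[OF S, of "Suc r"] k by simp
    moreover have "padic_p ^ Suc r dvd d * padic_p ^ r"
      using \<open>padic_p dvd d\<close> by (simp add: mult_dvd_mono)
    ultimately have "padic_p ^ Suc r dvd f (y + padic_p ^ r) - y"
      using dvd_add[of "padic_p ^ Suc r" "f (y + padic_p ^ r) - y - d * padic_p ^ r" "d * padic_p ^ r"] by simp
    with maps[OF S] show False by (simp add: mem_padic_sphere_iff)
  qed
  have "\<exists>j. padic_p ^ k dvd d ^ j - u" if u: "\<not> padic_p dvd u" for u
  proof (rule ccontr)
    assume not: "\<nexists>j. padic_p ^ k dvd d ^ j - u"
    \<comment> \<open>The first k digits of (z - y) / p^r are those of some power of d.\<close>
    define Q where "Q z \<longleftrightarrow> (\<exists>j. padic_p ^ (r + k) dvd z - (y + d ^ j * padic_p ^ r))" for z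
    define A where "A = ?S \<inter> {z. Q z}"
    have Q: "Q = (\<lambda>z. (\<lambda>c.
        \<exists>j. c = padic_residue (y + d ^ j * padic_p ^ r) (r + k)) (padic_residue z (r + k)))"
      by (rule ext) (simp add: Q_def p_power_dvd_diff_iff)
    have "open {z. Q z}" "open {z. \<not> Q z}"
      unfolding Q by (rule open_padic_residue_Collect)+
    moreover have "?S - A = ?S \<inter> {z. \<not> Q z}" by (auto simp: A_def)
    ultimately have openA: "open A" "open (?S - A)"
      by (simp_all only: A_def open_Int[OF open_padic_sphere])
    have A: "A \<in> sets borel" "A \<subseteq> ?S" using borel_open[OF openA(1)] by (auto simp: A_def)
    have "Q (f z) \<longleftrightarrow> Q z" if z: "z \<in> ?S" for z
    proof
      assume "Q z"
      then obtain j where j: "padic_p ^ (r + k) dvd z - (y + d ^ j * padic_p ^ r)"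
        by (auto simp: Q_def)
      have "padic_p ^ (r + k) dvd (f z - y - d * (z - y)) + d * (z - (y + d ^ j * padic_p ^ r))"
        using approx[OF z, of "r + k"] k by (intro dvd_add dvd_mult j) simp
      then have "padic_p ^ (r + k) dvd f z - (y + d ^ Suc j * padic_p ^ r)"
        by (simp add: algebra_simps)
      then show "Q (f z)" unfolding Q_def by blast
    next
      assume "Q (f z)"
      then obtain j where j: "padic_p ^ (r + k) dvd f z - (y + d ^ j * padic_p ^ r)"
        by (auto simp: Q_def)
      \<comment> \<open>Going back along \<open>f\<close> means dividing by d. Multiplication by
        \<open>d ^ (m - 1)\<close> does this modulo p^k and keeps the exponent of d a natural
        number.\<close>
      define m where "m = totient (CARD('p) ^ k)"
      have m: "m > 0" using prime_gt_0_nat[OF prime_card[where 'a='p]] by (simp add: m_def)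
      have "padic_p ^ (k + r) dvd (d ^ m - 1) * (z - y)"
        unfolding power_add m_def using padic_euler[OF unit, of k] z
        by (intro mult_dvd_mono) (auto simp: mem_padic_sphere_iff)
      then have euler: "padic_p ^ (r + k) dvd (d ^ m - 1) * (z - y)" by (simp add: add.commute)
      have "padic_p ^ (r + k) dvd f z - y - d * (z - y)"
        using approx[OF z] k by simp
      then have "padic_p ^ (r + k) dvd d ^ (m - 1) * (f z - (y + d ^ j * padic_p ^ r)) -
          d ^ (m - 1) * (f z - y - d * (z - y)) - (d ^ m - 1) * (z - y)"
        by (rule dvd_diff[OF dvd_diff[OF dvd_mult[OF j] dvd_mult] euler])
      also have "d ^ (m - 1) * (f z - (y + d ^ j * padic_p ^ r)) -
          d ^ (m - 1) * (f z - y - d * (z - y)) - (d ^ m - 1) * (z - y) =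
          z - (y + d ^ (m - 1 + j) * padic_p ^ r)"
        using m by (cases m) (simp_all add: algebra_simps power_add)
      finally show "Q z" unfolding Q_def by blast
    qed
    then have "f -` A \<inter> ?S = A" using maps by (auto simp: A_def)
    then have "emeasure (sphere_measure y r) A \<in> {0, 1}"
      using erg A by (simp add: ergodic_on_sphere_def ergodic_map_def space_sphere_measure sets_sphere_measure_iff)
    moreover have "Q (y + padic_p ^ r)" unfolding Q_def by (rule exI[of _ 0]) simp
    then have "emeasure ?H A > 0"
      using base_point_in_padic_sphere[of y r] by (intro emeasure_haar_open_pos[OF openA(1)]) (auto simp: A_def)
    then have "emeasure (sphere_measure y r) A \<noteq> 0"
      using emeasure_haar_ne_top[of ?S]
      by (auto simp: emeasure_sphere_measure[OF A] ennreal_divide_eq_0_iff)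
    ultimately have "emeasure ?H A = emeasure ?H ?S"
      using emeasure_sphere_measure_eq_1_iff[OF A] by auto
    moreover have "emeasure ?H ?S = emeasure ?H A + emeasure ?H (?S - A)"
    proof -
      have "emeasure ?H (A \<union> (?S - A)) = emeasure ?H A + emeasure ?H (?S - A)"
        using A by (intro plus_emeasure[symmetric]) auto
      moreover have "A \<union> (?S - A) = ?S" using A by blast
      ultimately show ?thesis by simp
    qed
    ultimately have null: "emeasure ?H (?S - A) = 0"
      using ennreal_add_left_cancel[of "emeasure ?H A" "emeasure ?H (?S - A)" 0] by simp
    have "y + padic_p ^ r * u \<in> ?S - A"
    proof -
      have "\<not> padic_p ^ (r + k) dvd padic_p ^ r * (u - d ^ j)" for j
        unfolding p_power_dvd_p_power_mult_iff using not dvd_diff_sym by blast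
      then have "\<not> Q (y + padic_p ^ r * u)" by (simp add: Q_def algebra_simps)
      with u show ?thesis by (simp add: A_def mem_padic_sphere_iff_unit)
    qed
    from emeasure_haar_open_pos[OF openA(2) this] null show False by simp
  qed
  with unit show ?thesis by (simp add: generates_padic_units_def d_def)
qed

text \<open>Modulo p^r the points y and y + p^r coincide, hence so do their images, and the second
  image lies on the sphere around y. Thus \<open>f y\<close> agrees with y to every order.\<close>

lemma ergodic_on_small_spheres_imp_fixed:
  fixes f :: "'p::prime_card padic_int \<Rightarrow> 'p padic_int"
  assumes f: "C_function f" and erg: "\<And>r. r \<ge> R \<Longrightarrow> ergodic_on_sphere f y r"
  shows "f y = y"
proof -
  have "padic_p ^ r dvd f y - y" if "r \<ge> R" for r
  proof -
    have z: "y + padic_p ^ r \<in> padic_sphere y r" by (rule base_point_in_padic_sphere)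
    with erg[OF that] have "f (y + padic_p ^ r) \<in> padic_sphere y r"
      by (auto simp: ergodic_on_sphere_def)
    then have "padic_p ^ r dvd f (y + padic_p ^ r) - y" by (simp add: mem_padic_sphere_iff)
    moreover have "padic_p ^ r dvd f y - f (y + padic_p ^ r)"
      by (rule C_function_dvd[OF f]) simp
    ultimately show ?thesis by (rule dvd_diff_trans[rotated])
  qed
  then have "padic_p ^ r dvd f y - y" for r
    using p_power_dvd_lower[of "max r R" "f y - y" r] by simp
  then show ?thesis
    by (intro padic_int_eqI) (simp add: p_power_dvd_diff_iff)
qed

section \<open>Sufficiency: isometry and digit-by-digit transitivity\<close>

section \<open>Ergodicity around a fixed point with generating derivative\<close>

lemma p_power_Suc_dvd_p_power_mult_iff:
  fixes x :: "'p::prime_card padic_int"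
  shows "padic_p ^ Suc n dvd padic_p ^ n * x \<longleftrightarrow> padic_p dvd x"
  using p_power_dvd_p_power_mult_iff[of n 1 x] by simp

text \<open>Valuations add, because a product of units is a unit.\<close>

lemma exact_p_power_mult:
  fixes x y :: "'p::prime_card padic_int"
  assumes "padic_p ^ m dvd x" "\<not> padic_p ^ Suc m dvd x" "padic_p ^ n dvd y" "\<not> padic_p ^ Suc n dvd y"
  shows "padic_p ^ (m + n) dvd x * y" "\<not> padic_p ^ Suc (m + n) dvd x * y"
proof -
  from assms(1,3) obtain u v where uv: "x = padic_p ^ m * u" "y = padic_p ^ n * v"
    by (auto elim!: dvdE)
  then have xy: "x * y = padic_p ^ (m + n) * (u * v)" by (simp add: power_add ac_simps)
  have "\<not> padic_p dvd u" "\<not> padic_p dvd v"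
    using assms(2,4) unfolding uv p_power_Suc_dvd_p_power_mult_iff by auto
  then have "\<not> padic_p dvd u * v" by (rule not_p_dvd_mult)
  then show "\<not> padic_p ^ Suc (m + n) dvd x * y"
    unfolding xy p_power_Suc_dvd_p_power_mult_iff .
  show "padic_p ^ (m + n) dvd x * y" unfolding xy by simp
qed

lemma exact_p_power_cong:
  fixes x y :: "'p::prime_card padic_int"
  assumes "padic_p ^ n dvd y" "\<not> padic_p ^ Suc n dvd y" "padic_p ^ Suc n dvd x - y"
  shows "padic_p ^ n dvd x" "\<not> padic_p ^ Suc n dvd x"
proof -
  have "padic_p ^ n dvd (x - y) + y"
    using assms(1) p_power_dvd_lower[OF assms(3), of n] by (intro dvd_add) simp_all
  then show "padic_p ^ n dvd x" by simp
  show "\<not> padic_p ^ Suc n dvd x"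
  proof
    assume "padic_p ^ Suc n dvd x"
    then have "padic_p ^ Suc n dvd x - (x - y)" using assms(3) by (rule dvd_diff)
    with assms(2) show False by simp
  qed
qed

lemma padic_solve_mod_p:
  fixes u v :: "'p::prime_card padic_int"
  assumes "\<not> padic_p dvd u"
  shows "\<exists>t. padic_p dvd of_nat t * u - v"
proof -
  define m where "m = totient (CARD('p) ^ 1)"
  have m: "m > 0" using prime_gt_0_nat[OF prime_card[where 'a='p]] by (simp add: m_def)
  \<comment> \<open>The quotient v / u modulo p, with the inverse taken from Euler's
    theorem.\<close>
  define w where "w = v * u ^ (m - 1)"
  define t where "t = nat (padic_residue w 1)"
  have "padic_p ^ 1 dvd w - of_nat t"
    unfolding t_def by (rule p_power_dvd_diff_of_nat_residue)
  then have "padic_p ^ 1 dvd (u ^ m - 1) * v - (w - of_nat t) * u"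
    unfolding m_def by (rule dvd_diff[OF dvd_mult2[OF padic_euler[OF assms]] dvd_mult2])
  then have "padic_p dvd (u ^ m - 1) * v - (w - of_nat t) * u" by simp
  also have "(u ^ m - 1) * v - (w - of_nat t) * u = of_nat t * u - v"
    using m by (cases m) (simp_all add: w_def algebra_simps)
  finally show ?thesis ..
qed

text \<open>The bound on r gives 2r >= r + 3, so the approximation error vanishes modulo p^(r+3),
  the precision at which the first displacement must be known.\<close>

locale generating_fixed_point =
  fixes f :: "'p::prime_card padic_int \<Rightarrow> 'p padic_int" and y :: "'p padic_int" and r :: nat
  assumes odd_p: "odd CARD('p)" and C_f: "C_function f" and fixed: "f y = y"
    and generator: "generates_padic_units 2 (padic_deriv f y)" and r_ge_3: "r \<ge> 3"
begin

abbreviation "S \<equiv> padic_sphere y r"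
abbreviation "d \<equiv> padic_deriv f y"

lemma not_p_dvd_d: "\<not> padic_p dvd d"
  using generator by (simp add: generates_padic_units_def)

lemma totient_CARD_power_Suc: "n > 0 \<Longrightarrow> totient (CARD('p) ^ Suc n) = totient (CARD('p) ^ n) * CARD('p)"
  using prime_card[where 'a='p] by (simp add: totient_prime_power totient_prime_power_Suc del: power_Suc)
    (metis Suc_pred power_Suc mult.commute mult.assoc)

lemma iterate_dvd: "padic_p ^ n dvd z - z' \<Longrightarrow> padic_p ^ n dvd (f ^^ j) z - (f ^^ j) z'"
  by (induction j) (auto intro: C_function_dvd[OF C_f])

lemma iterate_ball: "padic_p ^ r dvd z - y \<Longrightarrow> padic_p ^ r dvd (f ^^ j) z - y"
proof (induction j)
  case (Suc j)
  then show ?case using C_function_dvd[OF C_f, of r "(f ^^ j) z" y] by (simp add: fixed)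
qed simp

text \<open>Errors do not accumulate under iteration: each step adds one divisible by the same power
  of p.\<close>

lemma iterate_linear_approx:
  assumes "padic_p ^ r dvd z - y" "padic_p ^ r dvd z' - y" "padic_p ^ n dvd z - z'"
  shows "padic_p ^ (n + r) dvd (f ^^ j) z - (f ^^ j) z' - d ^ j * (z - z')"
proof (induction j)
  case (Suc j)
  let ?a = "(f ^^ j) z" and ?b = "(f ^^ j) z'"
  have "padic_p ^ (n + r) dvd f ?a - f ?b - d * (?a - ?b)"
    by (intro C_function_linear_approx[OF C_f] iterate_ball iterate_dvd assms)
  then have "padic_p ^ (n + r) dvd (f ?a - f ?b - d * (?a - ?b)) + d * (?a - ?b - d ^ j * (z - z'))"
    using Suc.IH by (rule dvd_add[OF _ dvd_mult])
  then show ?case by (simp add: algebra_simps)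
qed simp

text \<open>If z - z' is divisible by p^i, the approximation error has r further digits, so d (z -
  z') gains a digit from the image difference; d is a unit, and the digits follow one by
  one.\<close>

lemma p_power_dvd_image_diff_iff:
  assumes "padic_p ^ r dvd z - y" "padic_p ^ r dvd z' - y"
  shows "padic_p ^ n dvd f z - f z' \<longleftrightarrow> padic_p ^ n dvd z - z'"
proof
  assume n: "padic_p ^ n dvd f z - f z'"
  have "padic_p ^ i dvd z - z'" if "i \<le> n" for i
    using that
  proof (induction i)
    case (Suc i)
    then have "padic_p ^ (i + r) dvd f z - f z' - d * (z - z')"
      using C_function_linear_approx[OF C_f assms] by simp
    then have "padic_p ^ Suc i dvd f z - f z' - d * (z - z')"
      by (rule p_power_dvd_lower) (use r_ge_3 in simp)
    with p_power_dvd_lower[OF n Suc.prems]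
    have "padic_p ^ Suc i dvd (f z - f z') - (f z - f z' - d * (z - z'))"
      by (rule dvd_diff)
    then have "padic_p ^ Suc i dvd d * (z - z')" by simp
    then show ?case by (simp only: p_power_dvd_unit_mult_iff[OF not_p_dvd_d])
  qed simp
  then show "padic_p ^ n dvd z - z'" by simp
qed (rule C_function_dvd[OF C_f])

lemma sphere_imp_ball: "z \<in> S \<Longrightarrow> padic_p ^ r dvd z - y"
  by (simp add: mem_padic_sphere_iff)

lemma maps_sphere: "z \<in> S \<Longrightarrow> f z \<in> S"
  using p_power_dvd_image_diff_iff[of z y] by (simp add: mem_padic_sphere_iff fixed del: power_Suc)

lemma iterate_maps_sphere: "z \<in> S \<Longrightarrow> (f ^^ j) z \<in> S"
  by (induction j) (auto intro: maps_sphere)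

text \<open>Successive increments of the orbit under g differ by the factor d^phi(p^n), which is 1
  modulo p^n. At the stated precision they are all equal, so t steps move by t times the first
  increment.\<close>

lemma displacement_multiple:
  assumes n: "n \<ge> 2" and z: "z \<in> S"
    and disp: "\<And>z. z \<in> S \<Longrightarrow> padic_p ^ (r + n) dvd (f ^^ totient (CARD('p) ^ n)) z - z"
  shows "padic_p ^ (r + n + 2) dvd (f ^^ (totient (CARD('p) ^ n) * t)) z - z -
    of_nat t * ((f ^^ totient (CARD('p) ^ n)) z - z)"
proof -
  define g where "g = f ^^ totient (CARD('p) ^ n)"
  define h where "h i = (g ^^ Suc i) z - (g ^^ i) z" for i
  have g: "g ^^ i = f ^^ (totient (CARD('p) ^ n) * i)" for i
    by (simp add: g_def funpow_mult)
  have gS: "(g ^^ i) z \<in> S" for i unfolding g by (rule iterate_maps_sphere[OF z])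
  have h: "padic_p ^ (r + n) dvd h i" for i
    using disp[OF gS[of i]] by (simp add: h_def g_def)
  have step: "padic_p ^ (r + n + 2) dvd h (Suc i) - h i" for i
  proof -
    have "padic_p ^ (r + n + r) dvd h (Suc i) - d ^ totient (CARD('p) ^ n) * h i"
      using iterate_linear_approx[OF sphere_imp_ball[OF gS] sphere_imp_ball[OF gS] h[unfolded h_def]]
      by (simp add: h_def g_def)
    then have 1: "padic_p ^ (r + n + 2) dvd h (Suc i) - d ^ totient (CARD('p) ^ n) * h i"
      by (rule p_power_dvd_lower) (use r_ge_3 in simp)
    \<comment> \<open>Here \<open>n \<ge> 2\<close> is what yields precision r + n + 2.\<close>
    have "padic_p ^ (n + (r + n)) dvd (d ^ totient (CARD('p) ^ n) - 1) * h i"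
      unfolding power_add[of _ n] by (rule mult_dvd_mono[OF padic_euler[OF not_p_dvd_d] h])
    then have "padic_p ^ (r + n + 2) dvd (d ^ totient (CARD('p) ^ n) - 1) * h i"
      by (rule p_power_dvd_lower) (use n in simp)
    from dvd_add[OF 1 this] show ?thesis by (simp add: algebra_simps)
  qed
  have hi: "padic_p ^ (r + n + 2) dvd h i - h 0" for i
    by (induction i) (simp, rule dvd_diff_trans[OF step])
  have "padic_p ^ (r + n + 2) dvd (g ^^ t) z - z - of_nat t * h 0"
  proof (induction t)
    case (Suc t)
    from dvd_add[OF Suc hi[of t]] show ?case by (simp add: h_def algebra_simps)
  qed simp
  then show ?thesis by (simp add: g h_def)
qed

text \<open>The iterate for n + 1 is the p-fold repetition of the one for n, so each step multiplies
  the displacement by p up to a smaller error.\<close>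

lemma displacement:
  assumes "n \<ge> 2" "z \<in> S"
  shows "padic_p ^ (r + n) dvd (f ^^ totient (CARD('p) ^ n)) z - z \<and>
    \<not> padic_p ^ Suc (r + n) dvd (f ^^ totient (CARD('p) ^ n)) z - z"
  using assms
proof (induction n arbitrary: z rule: dec_induct)
  case base
  \<comment> \<open>Up to p^(2r) the displacement is \<open>?e * (z - y)\<close>. The first factor
    has valuation exactly 2, since d generates and p is odd; the second has valuation r.\<close>
  let ?e = "d ^ totient (CARD('p) ^ 2) - 1"
  have "padic_p ^ (r + r) dvd (f ^^ totient (CARD('p) ^ 2)) z - (f ^^ totient (CARD('p) ^ 2)) y -
      d ^ totient (CARD('p) ^ 2) * (z - y)"
    using sphere_imp_ball[OF base] by (intro iterate_linear_approx) simp_all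
  moreover have "(f ^^ j) y = y" for j by (induction j) (simp_all add: fixed)
  ultimately have "padic_p ^ (r + r) dvd ((f ^^ totient (CARD('p) ^ 2)) z - z) - ?e * (z - y)"
    by (simp add: algebra_simps)
  then have approx: "padic_p ^ Suc (r + 2) dvd ((f ^^ totient (CARD('p) ^ 2)) z - z) - ?e * (z - y)"
    by (rule p_power_dvd_lower) (use r_ge_3 in simp)
  have "padic_p ^ 2 dvd ?e" "\<not> padic_p ^ Suc 2 dvd ?e"
    using padic_euler[OF not_p_dvd_d, of 2] not_p_cubed_dvd_generator_power[OF odd_p generator]
    by (simp_all add: numeral_3_eq_3 del: power_Suc)
  then have "padic_p ^ (r + 2) dvd ?e * (z - y)" "\<not> padic_p ^ Suc (r + 2) dvd ?e * (z - y)"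
    using exact_p_power_mult[of 2 ?e r "z - y"] base
    by (simp_all add: mem_padic_sphere_iff add.commute del: power_Suc)
  from exact_p_power_cong[OF this approx] show ?case by blast
next
  case (step n)
  let ?h = "(f ^^ totient (CARD('p) ^ n)) z - z"
  have h: "padic_p ^ (r + n) dvd ?h" "\<not> padic_p ^ Suc (r + n) dvd ?h"
    using step.IH[OF step.prems] by simp_all
  have p: "padic_p ^ 1 dvd (padic_p :: 'p padic_int)" "\<not> padic_p ^ Suc 1 dvd (padic_p :: 'p padic_int)"
    using p_power_Suc_dvd_p_power_mult_iff[of 1 "1 :: 'p padic_int"] not_p_dvd_1 by simp_all
  \<comment> \<open>The main term has valuation r + n + 1, so the congruence must hold one digit
    beyond that.\<close>
  have "padic_p ^ (r + n + 2) dvd (f ^^ (totient (CARD('p) ^ n) * CARD('p))) z - z - of_nat CARD('p) * ?h"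
    using step.hyps step.IH step.prems by (intro displacement_multiple) simp_all
  then have "padic_p ^ Suc (r + Suc n) dvd (f ^^ totient (CARD('p) ^ Suc n)) z - z - padic_p * ?h"
    using step.hyps totient_CARD_power_Suc[of n] by (simp add: padic_p_def)
  moreover have "padic_p ^ (r + Suc n) dvd padic_p * ?h" "\<not> padic_p ^ Suc (r + Suc n) dvd padic_p * ?h"
    using exact_p_power_mult[OF p h] by (simp_all del: power_Suc)
  ultimately show ?case using exact_p_power_cong by blast
qed

lemma transitive:
  assumes z: "z \<in> S" and w: "w \<in> S" and n: "n \<ge> 2"
  shows "\<exists>j. padic_p ^ (r + n) dvd (f ^^ j) z - w"
  using n
proof (induction n rule: dec_induct)
  case base
  obtain u v where uv: "z - y = padic_p ^ r * u" "w - y = padic_p ^ r * v"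
    using sphere_imp_ball[OF z] sphere_imp_ball[OF w] by (auto elim!: dvdE)
  have "\<not> padic_p dvd u" "\<not> padic_p dvd v"
    using z w uv by (auto simp: mem_padic_sphere_iff p_power_Suc_dvd_p_power_mult_iff simp del: power_Suc)
  define m where "m = totient (CARD('p) ^ 2)"
  have m: "m > 0" using prime_gt_0_nat[OF prime_card[where 'a='p]] by (simp add: m_def)
  have "\<not> padic_p dvd v * u ^ (m - 1)"
    using \<open>\<not> padic_p dvd u\<close> \<open>\<not> padic_p dvd v\<close> by (intro not_p_dvd_mult not_p_dvd_power)
  \<comment> \<open>The target is v / u modulo p^2; it is a unit and hence a power of the generator
    d.\<close>
  then obtain j where j: "padic_p ^ 2 dvd d ^ j - v * u ^ (m - 1)"
    using generator unfolding generates_padic_units_def by blast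
  have "padic_p ^ 2 dvd (d ^ j - v * u ^ (m - 1)) * u + v * (u ^ m - 1)"
    using j padic_euler[OF \<open>\<not> padic_p dvd u\<close>, of 2] unfolding m_def by (intro dvd_add dvd_mult dvd_mult2)
  also have "(d ^ j - v * u ^ (m - 1)) * u + v * (u ^ m - 1) = d ^ j * u - v"
    using m by (cases m) (simp_all add: algebra_simps)
  finally have 1: "padic_p ^ (r + 2) dvd padic_p ^ r * (d ^ j * u - v)"
    by (simp only: p_power_dvd_p_power_mult_iff)
  have "padic_p ^ (r + r) dvd (f ^^ j) z - (f ^^ j) y - d ^ j * (z - y)"
    using sphere_imp_ball[OF z] by (intro iterate_linear_approx) simp_all
  moreover have "(f ^^ j) y = y" by (induction j) (simp_all add: fixed)
  ultimately have "padic_p ^ (r + r) dvd (f ^^ j) z - y - d ^ j * (z - y)" by simp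
  then have 2: "padic_p ^ (r + 2) dvd (f ^^ j) z - y - d ^ j * (z - y)"
    by (rule p_power_dvd_lower) (use r_ge_3 in simp)
  have "(f ^^ j) z - y - d ^ j * (z - y) + padic_p ^ r * (d ^ j * u - v) = (f ^^ j) z - w"
    using uv by (simp add: algebra_simps)
  with dvd_add[OF 2 1] show ?case by (intro exI[of _ j]) simp
next
  case (step n)
  then obtain j where j: "padic_p ^ (r + n) dvd (f ^^ j) z - w" by blast
  define x where "x = (f ^^ j) z"
  have x: "x \<in> S" by (simp add: x_def iterate_maps_sphere z)
  let ?h = "(f ^^ totient (CARD('p) ^ n)) x - x"
  obtain u v where uv: "?h = padic_p ^ (r + n) * u" "w - x = padic_p ^ (r + n) * v"
    using displacement[OF step.hyps(1) x] dvd_diff_sym[OF j] by (auto simp: x_def elim!: dvdE)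
  then have "\<not> padic_p dvd u"
    using displacement[OF step.hyps(1) x] p_power_Suc_dvd_p_power_mult_iff[of "r + n" u] by metis
  \<comment> \<open>The digit at position r + n moves by \<open>t * u\<close> modulo p under t
    repetitions; t is chosen to hit the digit of w.\<close>
  then obtain t where "padic_p dvd of_nat t * u - v"
    using padic_solve_mod_p by blast
  then have 1: "padic_p ^ Suc (r + n) dvd padic_p ^ (r + n) * (of_nat t * u - v)"
    by (simp only: p_power_Suc_dvd_p_power_mult_iff)
  have "padic_p ^ (r + n + 2) dvd (f ^^ (totient (CARD('p) ^ n) * t)) x - x - of_nat t * ?h"
    using displacement step.hyps(1) x by (intro displacement_multiple) simp_all
  then have "padic_p ^ Suc (r + n) dvd (f ^^ (totient (CARD('p) ^ n) * t)) x - x - of_nat t * ?h"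
    by (rule p_power_dvd_lower) simp
  from dvd_add[OF this 1] have "padic_p ^ Suc (r + n) dvd
      (f ^^ (totient (CARD('p) ^ n) * t)) x - x - of_nat t * ?h + padic_p ^ (r + n) * (of_nat t * u - v)" .
  also have "(f ^^ (totient (CARD('p) ^ n) * t)) x - x - of_nat t * ?h + padic_p ^ (r + n) * (of_nat t * u - v) =
      (f ^^ (totient (CARD('p) ^ n) * t)) x - w"
    using uv by (simp add: algebra_simps)
  finally have "padic_p ^ (r + Suc n) dvd (f ^^ (totient (CARD('p) ^ n) * t + j)) z - w"
    by (simp add: x_def funpow_add del: power_Suc)
  then show ?case ..
qed

lemma ergodic_sphere: "ergodic_on_sphere f y r"
proof -
  have "transitive_on_sphere f y r"
  proof
    fix n z z'
    show "padic_p ^ n dvd z - z' \<Longrightarrow> padic_p ^ n dvd f z - f z'"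
      by (rule C_function_dvd[OF C_f])
    show "z \<in> S \<Longrightarrow> f z \<in> S" by (rule maps_sphere)
    show "padic_p ^ n dvd z - z'" if "z \<in> S" "z' \<in> S" "padic_p ^ n dvd f z - f z'"
      using that p_power_dvd_image_diff_iff[of z z' n] sphere_imp_ball by blast
    show "\<exists>j. padic_p ^ n dvd (f ^^ j) z - z'" if "z \<in> S" "z' \<in> S"
      \<comment> \<open>Transitivity starts at level r + 2; coarser levels follow from it.\<close>
      using transitive[OF that, of "max n 2"] p_power_dvd_lower[of "r + max n 2" _ n] by fastforce
  qed
  then show ?thesis by (rule transitive_on_sphere.ergodic)
qed

end

theorem theorem1p3:
  fixes y :: "'p::prime_card padic_int"
  shows "(odd CARD('p) \<longrightarrow>
      (\<forall>f. C_function f \<longrightarrow>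
        ((\<exists>R\<ge>1. \<forall>r\<ge>R. ergodic_on_sphere f y r) \<longleftrightarrow>
          f y = y \<and>
          generates_units_mod (int CARD('p) ^ 2) (padic_residue (padic_deriv f y) 2)))) \<and>
    (CARD('p) = 2 \<longrightarrow>
      (\<forall>\<epsilon>>0. \<not> (\<exists>f. C_function f \<and>
        (\<forall>r\<ge>1. 1 / real CARD('p) ^ r < \<epsilon> \<longrightarrow> ergodic_on_sphere f y r))))"
proof (intro conjI impI allI)
  fix f :: "'p padic_int \<Rightarrow> 'p padic_int"
  assume odd: "odd CARD('p)" and f: "C_function f"
  have gen: "generates_units_mod (int CARD('p) ^ 2) (padic_residue (padic_deriv f y) 2) \<longleftrightarrow>
      generates_padic_units 2 (padic_deriv f y)"
    by (rule generates_units_mod_padic_residue_iff) simp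
  show "(\<exists>R\<ge>1. \<forall>r\<ge>R. ergodic_on_sphere f y r) \<longleftrightarrow>
      f y = y \<and> generates_units_mod (int CARD('p) ^ 2) (padic_residue (padic_deriv f y) 2)"
    unfolding gen
  proof
    assume "\<exists>R\<ge>1. \<forall>r\<ge>R. ergodic_on_sphere f y r"
    then obtain R where R: "\<And>r. r \<ge> R \<Longrightarrow> ergodic_on_sphere f y r" by blast
    then have fixed: "f y = y" by (rule ergodic_on_small_spheres_imp_fixed[OF f])
    moreover have "generates_padic_units 2 (padic_deriv f y)"
      \<comment> \<open>Any one sphere of exponent at least 2 suffices to test the derivative modulo
        p^2.\<close>
      by (rule ergodic_imp_generates_padic_units[OF f fixed R[of "max R 2"]]) simp_all
    ultimately show "f y = y \<and> generates_padic_units 2 (padic_deriv f y)" ..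
  next
    assume *: "f y = y \<and> generates_padic_units 2 (padic_deriv f y)"
    have "ergodic_on_sphere f y r" if "r \<ge> 3" for r
    proof -
      interpret generating_fixed_point f y r
        using odd f * that by unfold_locales simp_all
      show ?thesis by (rule ergodic_sphere)
    qed
    then show "\<exists>R\<ge>1. \<forall>r\<ge>R. ergodic_on_sphere f y r" by (intro exI[of _ 3]) simp
  qed
next
  fix \<epsilon> :: real
  assume two: "CARD('p) = 2" and "\<epsilon> > 0"
  show "\<not> (\<exists>f. C_function f \<and> (\<forall>r\<ge>1. 1 / real CARD('p) ^ r < \<epsilon> \<longrightarrow> ergodic_on_sphere f y r))"
  proof
    assume "\<exists>f. C_function f \<and> (\<forall>r\<ge>1. 1 / real CARD('p) ^ r < \<epsilon> \<longrightarrow> ergodic_on_sphere f y r)"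
    then obtain f where f: "C_function f"
      and erg: "\<And>r. r \<ge> 1 \<Longrightarrow> 1 / real CARD('p) ^ r < \<epsilon> \<Longrightarrow> ergodic_on_sphere f y r"
      by blast
    obtain N where N: "(1 / 2 :: real) ^ N < \<epsilon>"
      using real_arch_pow_inv[of \<epsilon> "1 / 2"] \<open>\<epsilon> > 0\<close> by auto
    \<comment> \<open>\<open>N\<close> makes the radius smaller than \<open>\<epsilon>\<close>; 3 is
      the level at which the units modulo powers of 2 fail to be cyclic.\<close>
    have R: "ergodic_on_sphere f y r" if "r \<ge> max N 3" for r
    proof (rule erg)
      have "(1 / 2 :: real) ^ r \<le> (1 / 2) ^ N"
        using that by (intro power_decreasing) auto
      with N show "1 / real CARD('p) ^ r < \<epsilon>" by (simp add: two power_one_over)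
    qed (use that in simp)
    then have fixed: "f y = y" by (rule ergodic_on_small_spheres_imp_fixed[OF f])
    have "generates_padic_units 3 (padic_deriv f y)"
      by (rule ergodic_imp_generates_padic_units[OF f fixed R[of "max N 3"]]) simp_all
    with not_generates_padic_units_mod_8[OF two] show False by blast
  qed
qed

end
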